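(* Let $f:\mathbb{R}\to\mathbb{R}$ be continuous with $l_f^\infty=\emptyset$. Then $L_f^\infty$ is a trim $G_\delta$ subset of $\mathbb{R}$. Conversely, if $E\subset\mathbb{R}$ is a trim $G_\delta$ set, then there exists a continuous function $f:\mathbb{R}\to\mathbb{R}$ such that $L_f^\infty=E$ and $l_f^\infty=\emptyset$; moreover, $f$ can be chosen so that in addition $\operatorname{lip} f(x)=0$ for all $x\in E$.
   Context: For a continuous $f:\mathbb{R}\to\mathbb{R}$, $x\in\mathbb{R}$ and $r>0$, let $M_f(x,r)=\sup\{|f(x)-f(y)|/r : |x-y|\le r\}$. Define $\operatorname{Lip} f(x)=\limsup_{r\to0^+}M_f(x,r)$ and $\operatorname{lip} f(x)=\liminf_{r\to0^+}M_f(x,r)$ (values in $[0,\infty]$). Let $L_f^\infty=\{x\in\mathbb{R}:\operatorname{Lip} f(x)=\infty\}$ and $l_f^\infty=\{x\in\mathbb{R}:\operatorname{lip} f(x)=\infty\}$. A set $E\subset\mathbb{R}$ is called trim if $|E\cap(a,b)|<b-a$ for every open interval $(a,b)$ with $a<b$, where $|\cdot|$ denotes Lebesgue (outer) measure. *)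

theory Defs
  imports "HOL-Analysis.Analysis"
begin

definition Mf :: "(real \<Rightarrow> real) \<Rightarrow> real \<Rightarrow> real \<Rightarrow> ereal" where
  "Mf f x r = (SUP y \<in> {y. \<bar>x - y\<bar> \<le> r}. ereal (\<bar>f x - f y\<bar> / r))"

definition Lip_upper :: "(real \<Rightarrow> real) \<Rightarrow> real \<Rightarrow> ereal" where
  "Lip_upper f x = Limsup (at_right 0) (Mf f x)"

definition lip_lower :: "(real \<Rightarrow> real) \<Rightarrow> real \<Rightarrow> ereal" where
  "lip_lower f x = Liminf (at_right 0) (Mf f x)"

definition L_inf :: "(real \<Rightarrow> real) \<Rightarrow> real set" where
  "L_inf f = {x. Lip_upper f x = \<infinity>}"

definition l_inf :: "(real \<Rightarrow> real) \<Rightarrow> real set" where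
  "l_inf f = {x. lip_lower f x = \<infinity>}"

definition lebesgue_outer :: "real set \<Rightarrow> ennreal" where
  "lebesgue_outer E = (INF A \<in> {A \<in> sets lebesgue. E \<subseteq> A}. emeasure lebesgue A)"

definition trim :: "real set \<Rightarrow> bool" where
  "trim E \<longleftrightarrow> (\<forall>a b. a < b \<longrightarrow> lebesgue_outer (E \<inter> {a<..<b}) < ennreal (b - a))"

end

theory Submission
  imports Defs
begin

text \<open>
  If \<open>lip f\<close> is finite everywhere, the line is a countable union of sets on which \<open>f\<close> oscillates at
  most linearly at arbitrarily small scales. Vitali's covering lemma on these sets shows that \<open>f\<close>
  maps null sets to null sets and that almost every fibre is countable. A closed countable
  fibre over a value strictly between \<open>f a\<close> and \<open>f b\<close> has a point, isolated among the sign changes,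
  at which \<open>f\<close> crosses the level; almost every crossing point has \<open>Lip f < \<infinity>\<close>, as for
  monotone functions. So the points of \<open>(a, b)\<close> with \<open>Lip f < \<infinity>\<close> have an image of
  positive measure and thus positive measure themselves.

  Conversely, let \<open>E\<close> be the intersection of open sets \<open>G n\<close>. As \<open>E\<close> is trim, every interval contains a
  compact set \<open>K\<close> of positive measure missing \<open>E\<close>, and a tent function of \<open>x \<mapsto> |K \<inter> (-\<infinity>, x]|\<close> is a Lipschitz
  bump that is locally constant off \<open>K\<close>. Steep bumps on tiny cells of an open set \<open>U n\<close> give a function
  \<open>\<phi> n\<close>, bounded by the squared distance to the complement of \<open>U n\<close>; then \<open>U (n + 1)\<close> is the part of
  \<open>U n \<inter> G (n + 1)\<close> where \<open>\<phi> n\<close> is locally constant. The sum of the \<open>\<phi> n\<close> is the required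
  function: near a point of \<open>E\<close>, at the scale of \<open>U n\<close>, the earlier terms are constant, the later ones
  are negligible, and \<open>\<phi> n\<close> is steep just outside \<open>U (n + 1)\<close> and constant inside.
\<close>

section \<open>Pointwise Lipschitz constants\<close>

lemma Mf_le_iff:
  assumes "0 < r"
  shows "Mf f x r \<le> ereal c \<longleftrightarrow> (\<forall>y. \<bar>x - y\<bar> \<le> r \<longrightarrow> \<bar>f x - f y\<bar> \<le> c * r)"
  using assms by (auto simp: Mf_def SUP_le_iff field_simps)

lemma Mf_nonneg:
  assumes "0 < r"
  shows "0 \<le> Mf f x r"
proof -
  have "ereal (\<bar>f x - f x\<bar> / r) \<le> Mf f x r"
    unfolding Mf_def by (rule SUP_upper) (use assms in auto)
  then show ?thesis by (simp add: zero_ereal_def)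
qed

text \<open>The radius \<open>r = \<bar>x - y\<bar>\<close> turns a bound on \<open>Mf\<close> into
  a pointwise Lipschitz estimate at \<open>x\<close>; later arguments use this form, free of
  limits.\<close>

lemma not_in_L_inf_iff:
  "x \<notin> L_inf f \<longleftrightarrow> (\<exists>C. \<exists>\<delta>>0. \<forall>y. \<bar>x - y\<bar> < \<delta> \<longrightarrow> \<bar>f x - f y\<bar> \<le> C * \<bar>x - y\<bar>)"
    (is "_ \<longleftrightarrow> ?R")
proof
  assume "x \<notin> L_inf f"
  then have "Limsup (at_right 0) (Mf f x) \<noteq> \<infinity>"
    by (simp add: L_inf_def Lip_upper_def)
  then obtain C where "Limsup (at_right 0) (Mf f x) < ereal C"
    by (auto simp: less_PInf_Ex_of_nat)
  then have "eventually (\<lambda>r. Mf f x r < ereal C) (at_right 0)"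
    by (rule Limsup_lessD)
  then obtain \<delta> where \<delta>: "\<delta> > 0" "\<And>r. 0 < r \<Longrightarrow> r < \<delta> \<Longrightarrow> Mf f x r < ereal C"
    by (auto simp: eventually_at_right_field)
  have "\<bar>f x - f y\<bar> \<le> C * \<bar>x - y\<bar>" if "\<bar>x - y\<bar> < \<delta>" for y
  proof (cases "x = y")
    case False
    then show ?thesis
      using \<delta>(2)[of "\<bar>x - y\<bar>"] that Mf_le_iff[of "\<bar>x - y\<bar>" f x C] by (auto dest: less_imp_le)
  qed simp
  with \<delta>(1) show ?R by blast
next
  assume ?R
  then obtain C \<delta> where *: "\<delta> > 0" "\<And>y. \<bar>x - y\<bar> < \<delta> \<Longrightarrow> \<bar>f x - f y\<bar> \<le> C * \<bar>x - y\<bar>"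
    by blast
  have "eventually (\<lambda>r. Mf f x r \<le> ereal (max C 0)) (at_right 0)"
    unfolding eventually_at_right_field
  proof (intro exI[of _ \<delta>] conjI allI impI)
    fix r :: real assume r: "r > 0" "r < \<delta>"
    have "\<bar>f x - f y\<bar> \<le> max C 0 * r" if "\<bar>x - y\<bar> \<le> r" for y
    proof -
      have "\<bar>f x - f y\<bar> \<le> C * \<bar>x - y\<bar>" using *(2) r that by auto
      also have "\<dots> \<le> max C 0 * r" by (intro mult_mono) (use that in auto)
      finally show ?thesis .
    qed
    then show "Mf f x r \<le> ereal (max C 0)" using r(1) Mf_le_iff by blast
  qed (use * in auto)
  then have "Limsup (at_right 0) (Mf f x) \<le> ereal (max C 0)"
    by (rule Limsup_bounded)
  then have "Limsup (at_right 0) (Mf f x) < \<infinity>" by (rule le_less_trans) (simp del: ereal_max)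
  then show "x \<notin> L_inf f" by (simp add: L_inf_def Lip_upper_def)
qed

text \<open>One natural number controls both steepness and scale, so the condition is a countable
  intersection; \<open>gdelta_L_inf\<close> reads its open sets off from it.\<close>

lemma in_L_inf_iff:
  "x \<in> L_inf f \<longleftrightarrow> (\<forall>n::nat. \<exists>y. \<bar>x - y\<bar> < 1 / (real n + 1) \<and> real n * \<bar>x - y\<bar> < \<bar>f x - f y\<bar>)"
    (is "_ \<longleftrightarrow> ?R")
proof
  assume "x \<in> L_inf f"
  show ?R
  proof
    fix n :: nat
    have "1 / (real n + 1) > 0" by simp
    with \<open>x \<in> L_inf f\<close> show "\<exists>y. \<bar>x - y\<bar> < 1 / (real n + 1) \<and> real n * \<bar>x - y\<bar> < \<bar>f x - f y\<bar>"
      using not_in_L_inf_iff[of x f] by (meson not_le)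
  qed
next
  assume R: ?R
  show "x \<in> L_inf f"
  proof (rule ccontr)
    assume "x \<notin> L_inf f"
    then obtain C \<delta> where *: "\<delta> > 0" "\<And>y. \<bar>x - y\<bar> < \<delta> \<Longrightarrow> \<bar>f x - f y\<bar> \<le> C * \<bar>x - y\<bar>"
      unfolding not_in_L_inf_iff by blast
    obtain n :: nat where n: "real n > max C (1 / \<delta>)" using reals_Archimedean2 by blast
    obtain y where y: "\<bar>x - y\<bar> < 1 / (real n + 1)" "real n * \<bar>x - y\<bar> < \<bar>f x - f y\<bar>"
      using R by blast
    have "1 / (real n + 1) < \<delta>" using n *(1) by (simp add: field_simps)
    then have "\<bar>f x - f y\<bar> \<le> C * \<bar>x - y\<bar>" using y *(2) by auto
    also have "\<dots> \<le> real n * \<bar>x - y\<bar>" by (intro mult_right_mono) (use n in auto)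
    finally show False using y by simp
  qed
qed

lemma in_L_infI:
  assumes "\<And>c \<delta>. c > 0 \<Longrightarrow> \<delta> > 0 \<Longrightarrow> \<exists>y. \<bar>x - y\<bar> < \<delta> \<and> c * \<bar>x - y\<bar> < \<bar>f x - f y\<bar>"
  shows "x \<in> L_inf f"
proof (rule ccontr)
  assume "x \<notin> L_inf f"
  then obtain C \<delta> where *: "\<delta> > 0" "\<And>y. \<bar>x - y\<bar> < \<delta> \<Longrightarrow> \<bar>f x - f y\<bar> \<le> C * \<bar>x - y\<bar>"
    unfolding not_in_L_inf_iff by blast
  obtain y where y: "\<bar>x - y\<bar> < \<delta>" "max C 1 * \<bar>x - y\<bar> < \<bar>f x - f y\<bar>"
    using assms[of "max C 1" \<delta>] * by (meson less_max_iff_disj zero_less_one)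
  have "C * \<bar>x - y\<bar> \<le> max C 1 * \<bar>x - y\<bar>" by (intro mult_right_mono) auto
  then show False using *(2)[OF y(1)] y(2) by linarith
qed

lemma l_inf_subset_L_inf: "l_inf f \<subseteq> L_inf f"
proof
  fix x assume "x \<in> l_inf f"
  moreover have "lip_lower f x \<le> Lip_upper f x"
    unfolding lip_lower_def Lip_upper_def by (rule Liminf_le_Limsup) simp
  ultimately show "x \<in> L_inf f" by (simp add: l_inf_def L_inf_def)
qed

text \<open>Supplies the countable cover of the complement of \<open>l_inf f\<close> by the sets
  \<open>scaled_osc_le f n\<close>.\<close>

lemma not_in_l_infD:
  assumes "x \<notin> l_inf f"
  shows "\<exists>n::nat. \<forall>\<delta>>0. \<exists>r>0. r < \<delta> \<and> (\<forall>y. \<bar>x - y\<bar> \<le> r \<longrightarrow> \<bar>f x - f y\<bar> \<le> real n * r)"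
proof -
  have "Liminf (at_right 0) (Mf f x) \<noteq> \<infinity>"
    using assms by (simp add: l_inf_def lip_lower_def)
  then obtain n :: nat where n: "Liminf (at_right 0) (Mf f x) < ereal (real n)"
    by (auto simp: less_PInf_Ex_of_nat)
  have "\<exists>r>0. r < \<delta> \<and> (\<forall>y. \<bar>x - y\<bar> \<le> r \<longrightarrow> \<bar>f x - f y\<bar> \<le> real n * r)" if "\<delta> > 0" for \<delta> :: real
  proof (rule ccontr)
    assume no: "\<not> ?thesis"
    have "eventually (\<lambda>r. ereal n \<le> Mf f x r) (at_right 0)"
      unfolding eventually_at_right_field
    proof (rule exI[of _ \<delta>], intro conjI allI impI)
      show "\<delta> > 0" by fact
      fix r :: real assume r: "r > 0" "r < \<delta>"
      then have "\<not> Mf f x r \<le> ereal n" using no Mf_le_iff[of r f x n] by blast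
      then show "ereal n \<le> Mf f x r" by simp
    qed
    then show False using Liminf_bounded n by fastforce
  qed
  then show ?thesis by blast
qed

lemma lip_lower_eq_0I:
  assumes "\<And>e \<delta>. e > 0 \<Longrightarrow> \<delta> > 0 \<Longrightarrow>
    \<exists>r>0. r < \<delta> \<and> (\<forall>y. \<bar>x - y\<bar> \<le> r \<longrightarrow> \<bar>f x - f y\<bar> \<le> e * r)"
  shows "lip_lower f x = 0"
proof (rule antisym)
  show "0 \<le> lip_lower f x"
    unfolding lip_lower_def
    by (rule Liminf_bounded) (auto simp: eventually_at_right_field Mf_nonneg intro!: exI[of _ 1])
  show "lip_lower f x \<le> 0"
  proof (rule ccontr)
    assume "\<not> lip_lower f x \<le> 0"
    then have "0 < lip_lower f x" by simp
    then obtain e where e: "0 < ereal e" "ereal e < lip_lower f x"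
      using ereal_dense2 by blast
    have "eventually (\<lambda>r. ereal e < Mf f x r) (at_right 0)"
      using e(2) unfolding lip_lower_def by (rule less_LiminfD)
    then obtain \<delta> where \<delta>: "\<delta> > 0" "\<And>r. 0 < r \<Longrightarrow> r < \<delta> \<Longrightarrow> ereal e < Mf f x r"
      by (auto simp: eventually_at_right_field)
    then obtain r where "r > 0" "r < \<delta>" "\<forall>y. \<bar>x - y\<bar> \<le> r \<longrightarrow> \<bar>f x - f y\<bar> \<le> e * r"
      using assms[of e \<delta>] e by auto
    then show False using \<delta>(2)[of r] Mf_le_iff[of r f x e] by auto
  qed
qed

lemma gdelta_L_inf:
  assumes "continuous_on UNIV f"
  shows "gdelta_in euclideanreal (L_inf f)"
proof -
  define U where "U n = {x. \<exists>y. \<bar>x - y\<bar> < 1 / (real n + 1) \<and> real n * \<bar>x - y\<bar> < \<bar>f x - f y\<bar>}" for n :: nat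
  have "open (U n)" for n
  proof -
    \<comment> \<open>For fixed \<open>y\<close> both conditions on \<open>x\<close> are open, the
      second one by continuity of \<open>f\<close>.\<close>
    have "U n = (\<Union>y. {x. \<bar>x - y\<bar> < 1 / (real n + 1)} \<inter> {x. real n * \<bar>x - y\<bar> < \<bar>f x - f y\<bar>})"
      by (auto simp: U_def)
    also have "open \<dots>"
      by (intro open_UN ballI open_Int open_Collect_less continuous_intros assms)
    finally show ?thesis .
  qed
  moreover have "L_inf f = \<Inter> (range U)"
    using in_L_inf_iff[of _ f] by (auto simp: U_def)
  ultimately show ?thesis
    by (force intro!: gdelta_in_Inter intro: open_imp_gdelta_in)
qed

section \<open>Covering estimates\<close>

text \<open>The bound is \<open>c * r\<close> on the whole ball, not
  \<open>c * \<bar>x - y\<bar>\<close>, so the image of the ball lies in an interval of length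
  \<open>2 * c * r\<close>. Every \<open>x\<close> with \<open>lip_lower f x < ereal c\<close>
  belongs to the set.\<close>

definition scaled_osc_le :: "(real \<Rightarrow> real) \<Rightarrow> real \<Rightarrow> real set" where
  "scaled_osc_le f c = {x. \<forall>\<delta>>0. \<exists>r>0. r < \<delta> \<and> (\<forall>y. \<bar>x - y\<bar> \<le> r \<longrightarrow> \<bar>f x - f y\<bar> \<le> c * r)}"

text \<open>Vitali's lemma is applied to the balls of radius \<open>r / 5\<close>: their fivefold
  enlargements are then exactly the intervals on which the oscillation of \<open>f\<close> is controlled.\<close>

lemma scaled_osc_cover:
  assumes S: "S \<subseteq> scaled_osc_le f c" and U: "open U" "S \<subseteq> U" and "\<delta> > 0" "c \<ge> 0"
  obtains C where "countable C"
    and "\<And>x r. (x, r) \<in> C \<Longrightarrow> 0 < r \<and> r < \<delta>"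
    and "\<And>x r y. (x, r) \<in> C \<Longrightarrow> \<bar>x - y\<bar> \<le> r \<Longrightarrow> \<bar>f x - f y\<bar> \<le> c * r"
    and "S \<subseteq> (\<Union>(x, r)\<in>C. ball x r)"
    and "(\<integral>\<^sup>+ p. ennreal (2 * c * snd p) \<partial>count_space C) \<le> ennreal (5 * c) * emeasure lborel U"
proof -
  \<comment> \<open>Requiring \<open>ball x r \<subseteq> U\<close> bounds the total length of the
    disjoint balls by the measure of \<open>U\<close>.\<close>
  define K where "K = {(x, r). x \<in> S \<and> 0 < r \<and> r < \<delta> \<and> ball x r \<subseteq> U \<and> (\<forall>y. \<bar>x - y\<bar> \<le> r \<longrightarrow> \<bar>f x - f y\<bar> \<le> c * r)}"
  have cov: "S \<subseteq> (\<Union>p\<in>K. ball (fst p) (snd p / 5))"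
  proof
    fix x assume x: "x \<in> S"
    then obtain e where e: "e > 0" "ball x e \<subseteq> U" using U open_contains_ball by blast
    have "min \<delta> e > 0" using e \<open>\<delta> > 0\<close> by simp
    then obtain r where r: "r > 0" "r < min \<delta> e" "\<forall>y. \<bar>x - y\<bar> \<le> r \<longrightarrow> \<bar>f x - f y\<bar> \<le> c * r"
      using S x unfolding scaled_osc_le_def by blast
    then have "(x, r) \<in> K" using x e by (auto simp: K_def subset_iff)
    then show "x \<in> (\<Union>p\<in>K. ball (fst p) (snd p / 5))" using r by force
  qed
  have bd: "0 < snd p / 5 \<and> snd p / 5 \<le> \<delta>" if "p \<in> K" for p
    using that by (auto simp: K_def)
  obtain C where C: "countable C" "C \<subseteq> K"
     "pairwise (\<lambda>i j. disjnt (ball (fst i) (snd i / 5)) (ball (fst j) (snd j / 5))) C"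
     "S \<subseteq> (\<Union>p\<in>C. ball (fst p) (5 * (snd p / 5)))"
    using Vitali_covering_lemma_balls[OF cov bd] by blast
  show ?thesis
  proof
    show "countable C" by fact
    show "0 < r \<and> r < \<delta>" if "(x, r) \<in> C" for x r using that C(2) by (auto simp: K_def)
    show "\<bar>f x - f y\<bar> \<le> c * r" if "(x, r) \<in> C" "\<bar>x - y\<bar> \<le> r" for x r y
      using that C(2) by (auto simp: K_def)
    show "S \<subseteq> (\<Union>(x, r)\<in>C. ball x r)" using C(4) by (simp add: case_prod_beta)
    have "(\<integral>\<^sup>+ p. ennreal (2 * c * snd p) \<partial>count_space C)
        = (\<integral>\<^sup>+ p. ennreal (5 * c) * emeasure lborel (ball (fst p) (snd p / 5)) \<partial>count_space C)"
    proof (intro nn_integral_cong)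
      fix p assume "p \<in> space (count_space C)"
      then have "snd p > 0" using C(2) by (auto simp: K_def)
      moreover have "ball (fst p) (snd p / 5) = {fst p - snd p / 5<..<fst p + snd p / 5}"
        by (simp add: ball_eq_greaterThanLessThan)
      \<comment> \<open>Multiplied by \<open>5 * c\<close>, this length becomes
        \<open>2 * c * r\<close>, the length of the image interval of the enlarged ball.\<close>
      ultimately have "emeasure lborel (ball (fst p) (snd p / 5)) = ennreal (2 * snd p / 5)"
        by simp
      then show "ennreal (2 * c * snd p) = ennreal (5 * c) * emeasure lborel (ball (fst p) (snd p / 5))"
        using \<open>c \<ge> 0\<close> by (simp add: ennreal_mult'[symmetric] mult.assoc)
    qed
    also have "\<dots> = ennreal (5 * c) * (\<integral>\<^sup>+ p. emeasure lborel (ball (fst p) (snd p / 5)) \<partial>count_space C)"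
      by (rule nn_integral_cmult) simp
    also have "(\<integral>\<^sup>+ p. emeasure lborel (ball (fst p) (snd p / 5)) \<partial>count_space C)
        = emeasure lborel (\<Union>p\<in>C. ball (fst p) (snd p / 5))"
      by (rule emeasure_UN_countable[symmetric])
        (use C in \<open>auto simp: disjoint_family_on_def pairwise_def disjnt_def\<close>)
    also have "ennreal (5 * c) * \<dots> \<le> ennreal (5 * c) * emeasure lborel U"
    proof (intro mult_left_mono emeasure_mono UN_least)
      fix p assume "p \<in> C"
      then have "ball (fst p) (snd p) \<subseteq> U" "snd p > 0"
        using C(2) by (fastforce simp: K_def simp del: mem_ball)+
      moreover have "ball (fst p) (snd p / 5) \<subseteq> ball (fst p) (snd p)"
        using \<open>snd p > 0\<close> by (intro subset_ball) simp
      ultimately show "ball (fst p) (snd p / 5) \<subseteq> U" by blast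
    qed (use U in auto)
    finally show "(\<integral>\<^sup>+ p. ennreal (2 * c * snd p) \<partial>count_space C) \<le> ennreal (5 * c) * emeasure lborel U" .
  qed
qed

text \<open>The indicator of the union is at most the number of members containing the point, and
  Tonelli exchanges sum and integral. The index set is arbitrary countable because the Vitali
  families are sets of pairs without an enumeration.\<close>

lemma emeasure_UN_le_nn_integral:
  assumes "countable I" "\<And>i. i \<in> I \<Longrightarrow> X i \<in> sets M"
  shows "emeasure M (\<Union>i\<in>I. X i) \<le> (\<integral>\<^sup>+ i. emeasure M (X i) \<partial>count_space I)"
proof -
  have [measurable]: "(\<Union>i\<in>I. X i) \<in> sets M" using assms by blast
  have "emeasure M (\<Union>i\<in>I. X i) = (\<integral>\<^sup>+ x. indicator (\<Union>i\<in>I. X i) x \<partial>M)" by simp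
  also have "\<dots> \<le> (\<integral>\<^sup>+ x. (\<integral>\<^sup>+ i. indicator (X i) x \<partial>count_space I) \<partial>M)"
  proof (rule nn_integral_mono)
    fix x
    show "indicator (\<Union>i\<in>I. X i) x \<le> (\<integral>\<^sup>+ i. indicator (X i) x \<partial>count_space I)"
    proof (cases "x \<in> (\<Union>i\<in>I. X i)")
      case True
      then obtain i where i: "i \<in> I" "x \<in> X i" by blast
      have "(1::ennreal) = (\<integral>\<^sup>+ j. indicator {i} j \<partial>count_space I)"
        using i by (subst nn_integral_indicator) auto
      also have "\<dots> \<le> (\<integral>\<^sup>+ j. indicator (X j) x \<partial>count_space I)"
        using i by (intro nn_integral_mono) (auto simp: indicator_def)
      finally show ?thesis using True by simp
    qed simp
  qed
  also have "\<dots> = (\<integral>\<^sup>+ i. (\<integral>\<^sup>+ x. indicator (X i) x \<partial>M) \<partial>count_space I)"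
    using assms by (intro nn_integral_count_space_nn_integral) auto
  also have "\<dots> = (\<integral>\<^sup>+ i. emeasure M (X i) \<partial>count_space I)"
    using assms by (intro nn_integral_cong) auto
  finally show ?thesis .
qed

text \<open>An open superset of measure at most \<open>e'\<close> yields Vitali balls whose images
  have total length at most \<open>5 * c * e'\<close>.\<close>

lemma negligible_image_scaled_osc_le:
  assumes Z: "negligible Z" "Z \<subseteq> scaled_osc_le f c" and "c \<ge> 0"
  shows "negligible (f ` Z)"
  unfolding negligible_outer_le
proof (intro allI impI)
  fix e :: real assume "e > 0"
  \<comment> \<open>The \<open>+ 1\<close> keeps the denominator positive when
    \<open>c = 0\<close>.\<close>
  define e' where "e' = e / (5 * c + 1)"
  have e': "e' > 0" "5 * c * e' \<le> e"
    using \<open>e > 0\<close> \<open>c \<ge> 0\<close> by (auto simp: e'_def field_simps)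
  have Zl: "Z \<in> sets lebesgue" "emeasure lebesgue Z = 0"
    using Z(1) by (auto simp: negligible_iff_null_sets)
  obtain U where U: "open U" "Z \<subseteq> U" "U - Z \<in> lmeasurable" "emeasure lebesgue (U - Z) < ennreal e'"
    using sets_lebesgue_outer_open[OF Zl(1) e'(1)] by blast
  have "emeasure lebesgue U \<le> emeasure lebesgue Z + emeasure lebesgue (U - Z)"
    using emeasure_subadditive[of Z lebesgue "U - Z"] Zl U(2,3)
    by (metis Un_Diff_cancel fmeasurableD sup.absorb2)
  then have Ue: "emeasure lborel U \<le> ennreal e'"
    using U(1,4) Zl(2) by simp
  obtain C where C: "countable C" "\<And>x r. (x, r) \<in> C \<Longrightarrow> 0 < r \<and> r < 1"
    "\<And>x r y. (x, r) \<in> C \<Longrightarrow> \<bar>x - y\<bar> \<le> r \<Longrightarrow> \<bar>f x - f y\<bar> \<le> c * r"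
    "Z \<subseteq> (\<Union>(x, r)\<in>C. ball x r)"
    "(\<integral>\<^sup>+ p. ennreal (2 * c * snd p) \<partial>count_space C) \<le> ennreal (5 * c) * emeasure lborel U"
    using scaled_osc_cover[OF Z(2) U(1,2) zero_less_one \<open>c \<ge> 0\<close>] by blast
  define T where "T = (\<Union>p\<in>C. {f (fst p) - c * snd p .. f (fst p) + c * snd p})"
  have Tm: "T \<in> sets borel" unfolding T_def using C(1) by (intro sets.countable_UN'') auto
  have "emeasure lborel T \<le> (\<integral>\<^sup>+ p. emeasure lborel {f (fst p) - c * snd p .. f (fst p) + c * snd p} \<partial>count_space C)"
    unfolding T_def by (rule emeasure_UN_le_nn_integral) (use C in auto)
  also have "\<dots> = (\<integral>\<^sup>+ p. ennreal (2 * c * snd p) \<partial>count_space C)"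
  proof (intro nn_integral_cong)
    fix p assume "p \<in> space (count_space C)"
    then have "snd p > 0" using C(2)[of "fst p" "snd p"] by simp
    then have "0 \<le> c * snd p" using \<open>c \<ge> 0\<close> by simp
    then show "emeasure lborel {f (fst p) - c * snd p .. f (fst p) + c * snd p} = ennreal (2 * c * snd p)"
      by (subst emeasure_lborel_Icc) (auto simp: algebra_simps)
  qed
  also have "\<dots> \<le> ennreal (5 * c) * emeasure lborel U" by fact
  also have "\<dots> \<le> ennreal (5 * c) * ennreal e'" by (intro mult_left_mono Ue) simp
  also have "\<dots> \<le> ennreal e" using e' \<open>c \<ge> 0\<close> by (simp add: ennreal_mult'[symmetric] ennreal_leI)
  finally have le: "emeasure lebesgue T \<le> ennreal e" using Tm by simp
  show "\<exists>T. f ` Z \<subseteq> T \<and> T \<in> lmeasurable \<and> measure lebesgue T \<le> e"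
  proof (intro exI conjI)
    show "f ` Z \<subseteq> T"
    proof clarify
      fix z assume "z \<in> Z"
      then obtain x r where xr: "(x, r) \<in> C" "z \<in> ball x r" using C(4) by blast
      then have "\<bar>f x - f z\<bar> \<le> c * r" using C(3)[of x r z] by (auto simp: dist_real_def)
      then show "f z \<in> T" unfolding T_def using xr(1) by force
    qed
    show "T \<in> lmeasurable"
      using Tm le by (intro fmeasurableI) (auto simp: less_top[symmetric] top_unique)
    show "measure lebesgue T \<le> e"
      using le \<open>e > 0\<close> by (simp add: measure_def enn2real_leI)
  qed
qed

text \<open>A Banach indicatrix argument: the number \<open>G k y\<close> of image intervals over
  \<open>y\<close>, for a cover by balls of radius below \<open>1 / (k + 1)\<close>, has an integral
  bounded independently of \<open>k\<close>. By Fatou its lower limit is finite for almost every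
  \<open>y\<close>, and this limit bounds the cardinality of the fibre.\<close>

lemma AE_finite_fibre_scaled_osc_le:
  assumes S: "S \<subseteq> scaled_osc_le f c" "S \<subseteq> {a<..<b}" and "c \<ge> 0"
  shows "AE y in lborel. finite {x \<in> S. f x = y}"
proof -
  define P where "P k C \<longleftrightarrow> countable C \<and> (\<forall>x r. (x, r) \<in> C \<longrightarrow> 0 < r \<and> r < 1 / (real k + 1)) \<and>
    (\<forall>x r y. (x, r) \<in> C \<longrightarrow> \<bar>x - y\<bar> \<le> r \<longrightarrow> \<bar>f x - f y\<bar> \<le> c * r) \<and>
    S \<subseteq> (\<Union>(x, r)\<in>C. ball x r) \<and>
    (\<integral>\<^sup>+ p. ennreal (2 * c * snd p) \<partial>count_space C) \<le> ennreal (5 * c) * emeasure lborel {a<..<b}" for k :: nat and C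
  have "\<exists>C. P k C" for k
  proof -
    have "1 / (real k + 1) > 0" by simp
    then show ?thesis
      by (rule scaled_osc_cover[OF S(1) open_greaterThanLessThan S(2) _ \<open>c \<ge> 0\<close>])
        (rule exI, unfold P_def, blast)
  qed
  then obtain C where "\<And>k. P k (C k)" by metis
  then have C: "\<And>k. countable (C k)"
    "\<And>k x r. (x, r) \<in> C k \<Longrightarrow> 0 < r \<and> r < 1 / (real k + 1)"
    "\<And>k x r y. (x, r) \<in> C k \<Longrightarrow> \<bar>x - y\<bar> \<le> r \<Longrightarrow> \<bar>f x - f y\<bar> \<le> c * r"
    "\<And>k. S \<subseteq> (\<Union>(x, r)\<in>C k. ball x r)"
    "\<And>k. (\<integral>\<^sup>+ p. ennreal (2 * c * snd p) \<partial>count_space (C k)) \<le> ennreal (5 * c) * emeasure lborel {a<..<b}"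
    unfolding P_def by auto
  define I where "I p = {f (fst p) - c * snd p .. f (fst p) + c * snd p}" for p
  define G where "G k y = (\<integral>\<^sup>+ p. indicator (I p) y \<partial>count_space (C k))" for k y
  have Gm [measurable]: "G k \<in> borel_measurable lborel" for k
  proof -
    interpret sigma_finite_measure "count_space (C k)"
      by (rule sigma_finite_measure_count_space_countable) (rule C(1))
    have "(\<lambda>(y, p). indicator (I p) y :: ennreal) \<in> borel_measurable (lborel \<Otimes>\<^sub>M count_space (C k))"
      unfolding split_beta'
      by (rule measurable_compose_countable'[where f = "\<lambda>p x. indicator (I p) (fst x)" and g = snd and I = "C k"])
        (auto simp: C(1) I_def)
    then show ?thesis unfolding G_def[abs_def] by (rule borel_measurable_nn_integral)
  qed
  have Gint: "(\<integral>\<^sup>+ y. G k y \<partial>lborel) \<le> ennreal (5 * c) * emeasure lborel {a<..<b}" for k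
  proof -
    have "(\<integral>\<^sup>+ y. G k y \<partial>lborel) = (\<integral>\<^sup>+ p. (\<integral>\<^sup>+ y. indicator (I p) y \<partial>lborel) \<partial>count_space (C k))"
      unfolding G_def using C(1) by (intro nn_integral_count_space_nn_integral) (auto simp: I_def)
    also have "\<dots> = (\<integral>\<^sup>+ p. ennreal (2 * c * snd p) \<partial>count_space (C k))"
    proof (intro nn_integral_cong)
      fix p assume "p \<in> space (count_space (C k))"
      then have "snd p > 0" using C(2)[of "fst p" "snd p"] by simp
      then have "0 \<le> c * snd p" using \<open>c \<ge> 0\<close> by simp
      then show "(\<integral>\<^sup>+ y. indicator (I p) y \<partial>lborel) = ennreal (2 * c * snd p)"
        unfolding I_def by (simp add: algebra_simps)
    qed
    finally show ?thesis using C(5) by simp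
  qed
  have "(\<integral>\<^sup>+ y. liminf (\<lambda>k. G k y) \<partial>lborel) \<le> liminf (\<lambda>k. \<integral>\<^sup>+ y. G k y \<partial>lborel)"
    by (rule nn_integral_liminf) (rule Gm)
  also have "\<dots> \<le> ennreal (5 * c) * emeasure lborel {a<..<b}"
  proof -
    have "liminf (\<lambda>k. \<integral>\<^sup>+ y. G k y \<partial>lborel) \<le> liminf (\<lambda>k. ennreal (5 * c) * emeasure lborel {a<..<b})"
      by (rule Liminf_mono) (simp add: Gint)
    then show ?thesis by (simp add: Liminf_const)
  qed
  \<comment> \<open>Boundedness of \<open>S\<close> enters here: the interval has finite
    length.\<close>
  also have "\<dots> < top" by (cases "a \<le> b") (auto simp: ennreal_mult_less_top)
  finally have "(\<integral>\<^sup>+ y. liminf (\<lambda>k. G k y) \<partial>lborel) \<noteq> \<infinity>" by (simp add: less_top)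
  then have "AE y in lborel. liminf (\<lambda>k. G k y) \<noteq> \<infinity>"
    by (intro nn_integral_PInf_AE) measurable
  then show ?thesis
  proof eventually_elim
    fix y assume fin: "liminf (\<lambda>k. G k y) \<noteq> \<infinity>"
    show "finite {x \<in> S. f x = y}"
    proof (rule ccontr)
      assume inf: "infinite {x \<in> S. f x = y}"
      have "ennreal (real N) \<le> liminf (\<lambda>k. G k y)" for N :: nat
      proof -
        obtain T where T: "finite T" "card T = N" "T \<subseteq> {x \<in> S. f x = y}"
          using infinite_arbitrarily_large[OF inf] by blast
        define D where "D = (\<lambda>(s, t). \<bar>s - t\<bar>) ` ((T \<times> T) - Id)"
        have D: "finite D" "\<And>d. d \<in> D \<Longrightarrow> d > 0" using T by (auto simp: D_def)
        obtain d where d: "d > 0" "\<And>s t. s \<in> T \<Longrightarrow> t \<in> T \<Longrightarrow> s \<noteq> t \<Longrightarrow> d \<le> \<bar>s - t\<bar>"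
        proof
          \<comment> \<open>Inserting \<open>1\<close> provides a minimum even when \<open>T\<close>
            has fewer than two points.\<close>
          show "Min (insert 1 D) > 0" using D by simp
          fix s t assume "s \<in> T" "t \<in> T" "s \<noteq> t"
          then have "\<bar>s - t\<bar> \<in> D" unfolding D_def by force
          then show "Min (insert 1 D) \<le> \<bar>s - t\<bar>" using D by simp
        qed
        obtain k0 :: nat where k0: "2 / d < real k0" using reals_Archimedean2 by blast
        have "real N \<le> G k y" if "k \<ge> k0" for k
        proof -
          have kd: "2 / (real k + 1) < d"
          proof -
            have "2 / d < real k + 1" using k0 that by linarith
            then show ?thesis using d(1) by (simp add: field_simps)
          qed
          have "\<forall>t\<in>T. \<exists>p. p \<in> C k \<and> t \<in> ball (fst p) (snd p)" 
          proof
            fix t assume "t \<in> T"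
            then have "t \<in> (\<Union>(x, r)\<in>C k. ball x r)" using C(4)[of k] T(3) by blast
            then show "\<exists>p. p \<in> C k \<and> t \<in> ball (fst p) (snd p)" by (auto simp del: mem_ball)
          qed
          then obtain q where q: "\<And>t. t \<in> T \<Longrightarrow> q t \<in> C k \<and> t \<in> ball (fst (q t)) (snd (q t))" by metis
          \<comment> \<open>Two points in one ball are closer than \<open>2 / (k + 1) < d\<close>,
            so distinct points of the fibre choose distinct members of the cover.\<close>
          have inj: "inj_on q T"
          proof
            fix s t assume st: "s \<in> T" "t \<in> T" "q s = q t"
            have "snd (q s) < 1 / (real k + 1)" using q[OF st(1)] C(2)[of "fst (q s)" "snd (q s)" k] by simp
            moreover have "\<bar>s - t\<bar> < 2 * snd (q s)" using q[OF st(1)] q[OF st(2)] st(3) by (auto simp: dist_real_def)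
            ultimately have "\<bar>s - t\<bar> < d" using kd by linarith
            then show "s = t" using d(2)[of s t] st by linarith
          qed
          have "ennreal (real N) = (\<Sum>p\<in>q ` T. 1)" using T inj by (simp add: card_image ennreal_of_nat_eq_real_of_nat)
          also have "\<dots> = (\<integral>\<^sup>+ p. indicator (q ` T) p \<partial>count_space (C k))"
            using T q by (subst nn_integral_count_space'[of "q ` T"]) (auto simp: indicator_def)
          also have "\<dots> \<le> G k y" unfolding G_def
          proof (rule nn_integral_mono)
            fix p
            show "indicator (q ` T) p \<le> (indicator (I p) y :: ennreal)"
            proof (cases "p \<in> q ` T")
              case True
              then obtain t where t: "t \<in> T" "p = q t" by blast
              then have "\<bar>f (fst p) - f t\<bar> \<le> c * snd p"
                using q[OF t(1)] C(3)[of "fst p" "snd p" k t] by (auto simp: dist_real_def)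
              then have "y \<in> I p" using T(3) t by (auto simp: I_def)
              then show ?thesis by (simp add: indicator_def)
            qed simp
          qed
          finally show ?thesis .
        qed
        then show ?thesis by (intro Liminf_bounded) (auto simp: eventually_sequentially)
      qed
      moreover obtain N :: nat where "liminf (\<lambda>k. G k y) < ennreal (real N)"
        using ennreal_Ex_less_of_nat[of "liminf (\<lambda>k. G k y)"] fin
        by (auto simp: ennreal_of_nat_eq_real_of_nat less_top)
      ultimately show False by (meson not_le)
    qed
  qed
qed

section \<open>Crossing points\<close>

text \<open>Disjoint members of the interval family have non-overlapping images, so the increments of
  \<open>f\<close> over a disjoint subfamily add up to at most the oscillation of \<open>f\<close>.\<close>

lemma negligible_large_increments:
  fixes f :: "real \<Rightarrow> real"
  assumes R: "\<And>n x. n > 0 \<Longrightarrow> x \<in> B \<Longrightarrow>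
      \<exists>u v. (u, v) \<in> R \<and> p \<le> u \<and> u < v \<and> v \<le> q \<and> u \<le> x \<and> x \<le> v \<and> n * (v - u) < f v - f u"
    and sep: "\<And>u v u' v'. (u, v) \<in> R \<Longrightarrow> (u', v') \<in> R \<Longrightarrow> p \<le> u \<Longrightarrow> u < v \<Longrightarrow> v < u' \<Longrightarrow>
      u' < v' \<Longrightarrow> v' \<le> q \<Longrightarrow> f v \<le> f u'"
    and bdd: "\<And>x. p \<le> x \<Longrightarrow> x \<le> q \<Longrightarrow> \<bar>f x\<bar> \<le> M" and "0 \<le> M"
  shows "negligible B"
  unfolding negligible_outer_le
proof (intro allI impI)
  fix e :: real assume "e > 0"
  \<comment> \<open>Then \<open>5 / n * (2 * M) = e * M / (M + 1) \<le> e\<close>, with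
    \<open>5\<close> the Vitali factor and \<open>2 * M\<close> a bound for the total length of the
    images. The \<open>+ 1\<close> keeps \<open>n\<close> positive when
    \<open>M = 0\<close>.\<close>
  define n where "n = 10 * (M + 1) / e"
  have n: "n > 0" using \<open>e > 0\<close> \<open>0 \<le> M\<close> by (simp add: n_def)
  define K where "K = {(u, v). (u, v) \<in> R \<and> p \<le> u \<and> u < v \<and> v \<le> q \<and> n * (v - u) < f v - f u}"
  define m where "m i = (fst i + snd i) / 2" for i :: "real \<times> real"
  define \<rho> where "\<rho> i = (snd i - fst i) / 2" for i :: "real \<times> real"
  have cb: "cball (m i) (\<rho> i) = {fst i..snd i}" for i
    by (simp add: cball_eq_atLeastAtMost m_def \<rho>_def field_simps)
  have cov: "B \<subseteq> (\<Union>i\<in>K. cball (m i) (\<rho> i))"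
  proof
    fix x assume "x \<in> B"
    from R[OF n this] obtain u v where uv: "(u, v) \<in> K" "u \<le> x" "x \<le> v"
      unfolding K_def by blast
    then show "x \<in> (\<Union>i\<in>K. cball (m i) (\<rho> i))" unfolding cb by force
  qed
  have bd: "0 < \<rho> i \<and> \<rho> i \<le> \<bar>q - p\<bar>" if "i \<in> K" for i
    using that by (auto simp: K_def \<rho>_def)
  obtain C where C: "countable C" "C \<subseteq> K"
     "pairwise (\<lambda>i j. disjnt (cball (m i) (\<rho> i)) (cball (m j) (\<rho> j))) C"
     "B \<subseteq> (\<Union>i\<in>C. cball (m i) (5 * \<rho> i))"
    using Vitali_covering_lemma_cballs[OF cov bd] by blast
  define T where "T = (\<Union>i\<in>C. cball (m i) (5 * \<rho> i))"
  have Tm: "T \<in> sets borel" unfolding T_def using C(1) by (intro sets.countable_UN'') auto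
  \<comment> \<open>Open intervals, because the images of disjoint members may share an
    endpoint.\<close>
  define J where "J i = {f (fst i)<..<f (snd i)}" for i
  have disj: "disjoint_family_on J C"
    unfolding disjoint_family_on_def
  proof (intro ballI impI)
    fix i j assume ij: "i \<in> C" "j \<in> C" "i \<noteq> j"
    obtain u v u' v' where uv: "i = (u, v)" "j = (u', v')" by fastforce
    have K: "(u, v) \<in> K" "(u', v') \<in> K" using ij uv C(2) by auto
    then have lt: "u < v" "u' < v'" by (auto simp: K_def)
    have "{u..v} \<inter> {u'..v'} = {}"
      using C(3) ij uv unfolding cb pairwise_def disjnt_def by force
    then have "v < u' \<or> v' < u"
      using lt by (metis IntI atLeastAtMost_iff empty_iff less_eq_real_def linorder_not_le)
    then have "f v \<le> f u' \<or> f v' \<le> f u"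
      using sep[of u v u' v'] sep[of u' v' u v] K by (auto simp: K_def)
    then show "J i \<inter> J j = {}" unfolding J_def uv by auto
  qed
  have "emeasure lborel T \<le> (\<integral>\<^sup>+ i. emeasure lborel (cball (m i) (5 * \<rho> i)) \<partial>count_space C)"
    unfolding T_def by (rule emeasure_UN_le_nn_integral) (use C in auto)
  also have "\<dots> \<le> (\<integral>\<^sup>+ i. ennreal (5 / n) * emeasure lborel (J i) \<partial>count_space C)"
  proof (intro nn_integral_mono)
    fix i assume "i \<in> space (count_space C)"
    then have "i \<in> K" using C(2) by auto
    then obtain u v where uv: "i = (u, v)" "u < v" "n * (v - u) < f v - f u" by (auto simp: K_def)
    then have "f u \<le> f v" using n by (smt (verit) mult_pos_pos)
    then have "emeasure lborel (J i) = ennreal (f v - f u)" using uv by (simp add: J_def)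
    moreover have "emeasure lborel (cball (m i) (5 * \<rho> i)) = ennreal (5 * (v - u))"
      using uv(2) unfolding cball_eq_atLeastAtMost uv(1) m_def \<rho>_def
      by (subst emeasure_lborel_Icc) (auto simp: field_simps)
    moreover have "5 * (v - u) \<le> 5 / n * (f v - f u)" using uv(3) n by (simp add: field_simps)
    ultimately show "emeasure lborel (cball (m i) (5 * \<rho> i)) \<le> ennreal (5 / n) * emeasure lborel (J i)"
      using n \<open>f u \<le> f v\<close> by (simp add: ennreal_mult'[symmetric] ennreal_leI)
  qed
  also have "\<dots> = ennreal (5 / n) * (\<integral>\<^sup>+ i. emeasure lborel (J i) \<partial>count_space C)"
    by (rule nn_integral_cmult) simp
  also have "(\<integral>\<^sup>+ i. emeasure lborel (J i) \<partial>count_space C) = emeasure lborel (\<Union>i\<in>C. J i)"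
    by (rule emeasure_UN_countable[symmetric, OF _ C(1) disj]) (simp add: J_def)
  also have "\<dots> \<le> emeasure lborel {-M..M}"
  proof (intro emeasure_mono UN_least)
    fix i assume "i \<in> C"
    then have "i \<in> K" using C(2) by auto
    then have "\<bar>f (fst i)\<bar> \<le> M" "\<bar>f (snd i)\<bar> \<le> M" by (auto simp: K_def intro!: bdd)
    then show "J i \<subseteq> {-M..M}" by (auto simp: J_def)
  qed auto
  also have "emeasure lborel {-M..M} = ennreal (2 * M)" using \<open>0 \<le> M\<close> by simp
  also have "ennreal (5 / n) * ennreal (2 * M) \<le> ennreal e"
  proof -
    have "5 / n * (2 * M) \<le> e"
      using \<open>e > 0\<close> \<open>0 \<le> M\<close> by (simp add: n_def field_simps)
    then show ?thesis using n by (simp add: ennreal_mult'[symmetric] ennreal_leI)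
  qed
  finally have le: "emeasure lebesgue T \<le> ennreal e" using Tm by (simp add: mult_left_mono)
  show "\<exists>T. B \<subseteq> T \<and> T \<in> lmeasurable \<and> measure lebesgue T \<le> e"
  proof (intro exI conjI)
    show "B \<subseteq> T" using C(4) by (simp add: T_def)
    show "T \<in> lmeasurable"
      using Tm le by (intro fmeasurableI) (auto simp: less_top[symmetric] top_unique)
    show "measure lebesgue T \<le> e"
      using le \<open>e > 0\<close> by (simp add: measure_def enn2real_leI)
  qed
qed

text \<open>\<open>f\<close> need not be monotone on \<open>[p, q]\<close>, but comparisons of its
  values with those at crossing points behave as for a monotone function.\<close>

definition crossing :: "(real \<Rightarrow> real) \<Rightarrow> real \<Rightarrow> real \<Rightarrow> real set" where
  "crossing f p q = {x. p < x \<and> x < q \<and> (\<forall>t. p \<le> t \<and> t \<le> x \<longrightarrow> f t \<le> f x) \<and> (\<forall>t. x \<le> t \<and> t \<le> q \<longrightarrow> f x \<le> f t)}"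

text \<open>As in the proof that a monotone function has finite upper derivative almost everywhere:
  steep intervals that all begin, or all end, at crossing points satisfy the separation hypothesis
  of \<open>negligible_large_increments\<close>.\<close>

lemma negligible_L_inf_crossing:
  assumes "continuous_on UNIV f"
  shows "negligible (L_inf f \<inter> crossing f p q)"
proof -
  have "bounded (f ` {p..q})"
    using assms by (meson compact_Icc compact_continuous_image compact_imp_bounded continuous_on_subset subset_UNIV)
  then obtain M where M: "M > 0" "\<And>x. x \<in> {p..q} \<Longrightarrow> \<bar>f x\<bar> \<le> M"
    by (auto simp: bounded_pos)
  \<comment> \<open>\<open>s = 1\<close> and \<open>s = -1\<close> select a steep point
    \<open>y\<close> to the right and to the left of \<open>x\<close>.\<close>
  define D where "D s n x y \<longleftrightarrow> p \<le> y \<and> y \<le> q \<and> s * (y - x) > 0 \<and> n * \<bar>x - y\<bar> < \<bar>f x - f y\<bar>" for s n x y :: real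
  define B where "B s = {x \<in> crossing f p q. \<forall>n>0. \<exists>y. D s n x y}" for s
  have sub: "L_inf f \<inter> crossing f p q \<subseteq> B 1 \<union> B (-1)"
  proof clarify
    fix x assume x: "x \<in> L_inf f" "x \<in> crossing f p q" "x \<notin> B (-1)"
    then obtain n0 where n0: "n0 > 0" "\<And>y. \<not> D (-1) n0 x y" by (auto simp: B_def)
    show "x \<in> B 1"
      unfolding B_def
    proof (intro CollectI conjI allI impI)
      fix n :: real assume "n > 0"
      \<comment> \<open>At least \<open>n\<close> and \<open>n0\<close> for steepness, and so large
        that \<open>1 / (N + 1)\<close> keeps \<open>y\<close> inside \<open>[p, q]\<close>. Being
        steeper than \<open>n0\<close> rules out the left side.\<close>
      define N where "N = nat \<lceil>max (max n n0) (max (1 / (x - p)) (1 / (q - x)))\<rceil>"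
      have xpq: "p < x" "x < q" using x(2) by (auto simp: crossing_def)
      have N: "real N \<ge> n" "real N \<ge> n0" "real N \<ge> 1 / (x - p)" "real N \<ge> 1 / (q - x)"
        unfolding N_def by linarith+
      then have N': "1 / (real N + 1) \<le> x - p" "1 / (real N + 1) \<le> q - x"
        using xpq by (auto simp: field_simps)
      obtain y where y: "\<bar>x - y\<bar> < 1 / (real N + 1)" "real N * \<bar>x - y\<bar> < \<bar>f x - f y\<bar>"
        using x(1) unfolding in_L_inf_iff by blast
      have "n * \<bar>x - y\<bar> \<le> real N * \<bar>x - y\<bar>" "n0 * \<bar>x - y\<bar> \<le> real N * \<bar>x - y\<bar>"
        using N by (auto intro: mult_right_mono)
      then have "n * \<bar>x - y\<bar> < \<bar>f x - f y\<bar>" "n0 * \<bar>x - y\<bar> < \<bar>f x - f y\<bar>" using y by linarith+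
      moreover have "x \<noteq> y" using y by auto
      moreover have "p \<le> y" "y \<le> q" using y(1) N' by linarith+
      ultimately have "D 1 n x y" using n0(2)[of y] unfolding D_def by auto
      then show "\<exists>y. D 1 n x y" by blast
    qed fact
  qed
  have "negligible (B 1)"
  proof (rule negligible_large_increments[where R = "{(u, v). u \<in> crossing f p q}" and f = f and p = p and q = q and M = M])
    fix n x :: real assume "n > 0" "x \<in> B 1"
    then obtain y where xy: "x \<in> crossing f p q" "D 1 n x y" by (auto simp: B_def)
    then have "f x \<le> f y" by (auto simp: crossing_def D_def)
    then show "\<exists>u v. (u, v) \<in> {(u, v). u \<in> crossing f p q} \<and> p \<le> u \<and> u < v \<and> v \<le> q \<and> u \<le> x \<and> x \<le> v \<and> n * (v - u) < f v - f u"
      using xy by (intro exI[of _ x] exI[of _ y]) (auto simp: D_def crossing_def)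
  next
    fix u v u' v' assume "(u, v) \<in> {(u, v). u \<in> crossing f p q}" "(u', v') \<in> {(u, v). u \<in> crossing f p q}"
      "p \<le> u" "u < v" "v < u'"
    then show "f v \<le> f u'" by (auto simp: crossing_def)
  qed (use M in auto)
  moreover have "negligible (B (-1))"
  \<comment> \<open>Now the crossing point is the right endpoint, and separation comes from the end
    \<open>v\<close> of the earlier interval; for \<open>B 1\<close> it came from the beginning
    \<open>u'\<close> of the later one.\<close>
  proof (rule negligible_large_increments[where R = "{(u, v). v \<in> crossing f p q}" and f = f and p = p and q = q and M = M])
    fix n x :: real assume "n > 0" "x \<in> B (-1)"
    then obtain y where xy: "x \<in> crossing f p q" "D (-1) n x y" by (auto simp: B_def)
    then have "f y \<le> f x" by (auto simp: crossing_def D_def)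
    then show "\<exists>u v. (u, v) \<in> {(u, v). v \<in> crossing f p q} \<and> p \<le> u \<and> u < v \<and> v \<le> q \<and> u \<le> x \<and> x \<le> v \<and> n * (v - u) < f v - f u"
      using xy by (intro exI[of _ y] exI[of _ x]) (auto simp: D_def crossing_def)
  next
    fix u v u' v' assume "(u, v) \<in> {(u, v). v \<in> crossing f p q}" "(u', v') \<in> {(u, v). v \<in> crossing f p q}"
      "v < u'" "u' < v'" "v' \<le> q"
    then show "f v \<le> f u'" by (auto simp: crossing_def)
  qed (use M in auto)
  ultimately show ?thesis using sub negligible_Un negligible_subset by blast
qed

text \<open>By Baire: if no point were isolated, deleting any one point would leave a dense
  relatively open set, yet the countable intersection of these sets is empty.\<close>

lemma countable_closed_isolated:
  fixes S :: "real set"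
  assumes "closed S" "countable S" "S \<noteq> {}"
  obtains x where "x \<in> S" "\<not> x islimpt S"
proof -
  have "\<exists>x\<in>S. \<not> x islimpt S"
  proof (rule ccontr)
    assume "\<not> ?thesis"
    then have lim: "\<And>x. x \<in> S \<Longrightarrow> x islimpt S" by blast
    have "S \<subseteq> closure (\<Inter> ((\<lambda>x. S - {x}) ` S))"
    proof (rule Baire)
      show "countable ((\<lambda>x. S - {x}) ` S)" using assms by blast
      fix T assume "T \<in> (\<lambda>x. S - {x}) ` S"
      then obtain x where x: "x \<in> S" "T = S - {x}" by blast
      have "x \<in> closure (S - {x})" using lim[OF x(1)] unfolding closure_def islimpt_def by blast
      moreover have "S - {x} \<subseteq> closure (S - {x})" by (rule closure_subset)
      ultimately have "S \<subseteq> closure T" using x by blast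
      moreover have "openin (top_of_set S) T" unfolding x(2) by (intro openin_diff) (auto simp: x)
      ultimately show "openin (top_of_set S) T \<and> S \<subseteq> closure T" by blast
    qed fact
    moreover have "\<Inter> ((\<lambda>x. S - {x}) ` S) = {}" using assms(3) by blast
    ultimately show False using assms(3) by simp
  qed
  then show ?thesis using that by blast
qed

text \<open>The set \<open>C\<close> where both signs of \<open>f - y\<close> accumulate is a
  nonempty closed subset of the fibre, so it has an isolated point; near it the weak sign is fixed
  on each side and must differ between them. Rational \<open>p\<close> and \<open>q\<close> leave
  only countably many crossing sets.\<close>

lemma crossing_of_countable_fibre:
  fixes f :: "real \<Rightarrow> real"
  assumes cont: "continuous_on UNIV f" and "a < b" and y: "f a < y" "y < f b"
    and count: "countable {x \<in> {a..b}. f x = y}"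
  obtains x p q where "p \<in> \<rat>" "q \<in> \<rat>" "a < x" "x < b" "f x = y" "x \<in> crossing f p q \<union> crossing (\<lambda>t. - f t) p q"
proof -
  define A where "A = {x \<in> {a..b}. f x < y}"
  define B where "B = {x \<in> {a..b}. y < f x}"
  have "closed {x. f x \<le> y}" "closed {x. y \<le> f x}"
    using cont by (auto intro!: closed_Collect_le continuous_intros)
  then have "closed ({a..b} \<inter> {x. f x \<le> y})" "closed ({a..b} \<inter> {x. y \<le> f x})"
    by (auto intro: closed_Int)
  moreover have "A \<subseteq> {a..b} \<inter> {x. f x \<le> y}" "B \<subseteq> {a..b} \<inter> {x. y \<le> f x}"
    by (auto simp: A_def B_def)
  ultimately have clA: "closure A \<subseteq> {a..b} \<inter> {x. f x \<le> y}" and clB: "closure B \<subseteq> {a..b} \<inter> {x. y \<le> f x}"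
    by (meson closure_minimal)+
  \<comment> \<open>Otherwise the fibre over \<open>y\<close> would contain a nondegenerate interval
    and be uncountable.\<close>
  have dense: "{a..b} \<subseteq> closure A \<union> closure B"
  proof
    fix x assume x: "x \<in> {a..b}"
    show "x \<in> closure A \<union> closure B"
    proof (rule ccontr)
      assume "x \<notin> closure A \<union> closure B"
      then have "x \<notin> closure (A \<union> B)" by (simp add: closure_Un)
      then obtain e where e: "e > 0" "ball x e \<inter> (A \<union> B) = {}"
        by (metis disjoint_iff mem_ball not_in_closure_trivial_limitI closure_approachable dist_commute)
      define s where "s = max a (x - e / 2)"
      define t where "t = min b (x + e / 2)"
      have "s < t" using x \<open>a < b\<close> e by (auto simp: s_def t_def)
      have "{s..t} \<subseteq> {x \<in> {a..b}. f x = y}"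
      proof
        fix z assume z: "z \<in> {s..t}"
        then have "z \<in> ball x e" "z \<in> {a..b}" using e(1) by (auto simp: s_def t_def dist_real_def)
        then show "z \<in> {x \<in> {a..b}. f x = y}" using e(2) by (force simp: A_def B_def)
      qed
      then show False using count countable_subset uncountable_closed_interval[of s t] \<open>s < t\<close> by blast
    qed
  qed
  define C where "C = closure A \<inter> closure B"
  \<comment> \<open>Connectedness: the segment from \<open>u\<close> to \<open>v\<close> is covered
    by the two closures and meets both.\<close>
  have meet: "C \<inter> {min u v..max u v} \<noteq> {}" if "u \<in> A" "v \<in> B" for u v
  proof
    assume "C \<inter> {min u v..max u v} = {}"
    then have "closure A \<inter> closure B \<inter> {min u v..max u v} = {}" by (simp add: C_def)
    moreover have "{min u v..max u v} \<subseteq> closure A \<union> closure B"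
    proof -
      have "{min u v..max u v} \<subseteq> {a..b}" using that by (auto simp: A_def B_def)
      then show ?thesis using dense by blast
    qed
    moreover have "u \<in> closure A \<inter> {min u v..max u v}" "v \<in> closure B \<inter> {min u v..max u v}"
      using that closure_subset by auto
    ultimately show False
      using connected_closedD[of "{min u v..max u v}" "closure A" "closure B"] by auto
  qed
  have "a \<in> A" "b \<in> B" using y \<open>a < b\<close> by (auto simp: A_def B_def)
  then have "C \<noteq> {}" using meet by blast
  moreover have "closed C" by (auto simp: C_def)
  moreover have Cy: "C \<subseteq> {x \<in> {a..b}. f x = y}" unfolding C_def using clA clB by force
  then have "countable C" using count countable_subset by blast
  ultimately obtain x where x: "x \<in> C" "\<not> x islimpt C" using countable_closed_isolated by blast
  have fx: "f x = y" "a \<le> x" "x \<le> b" using x Cy by auto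
  with y have "a < x" "x < b" by (auto simp: less_le)
  obtain e where e: "e > 0" "\<And>z. z \<in> C \<Longrightarrow> dist z x < e \<Longrightarrow> z = x"
    using x(2) unfolding islimpt_approachable by auto
  obtain p where p: "p \<in> \<rat>" "max a (x - e) < p" "p < x"
    using Rats_dense_in_real[of "max a (x - e)" x] e(1) \<open>a < x\<close> by auto
  obtain q where q: "q \<in> \<rat>" "x < q" "q < min b (x + e)"
    using Rats_dense_in_real[of x "min b (x + e)"] e(1) \<open>x < b\<close> by auto
  \<comment> \<open>A sign change inside \<open>I\<close> would place, by \<open>meet\<close>, a
    second point of \<open>C\<close> within \<open>e\<close> of \<open>x\<close>.\<close>
  have one_side: "(\<forall>t\<in>I. f t \<le> y) \<or> (\<forall>t\<in>I. y \<le> f t)"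
    if I: "I = {p..<x} \<or> I = {x<..q}" for I
  proof (rule ccontr)
    assume "\<not> ?thesis"
    then obtain u v where uv: "u \<in> I" "v \<in> I" "f u < y" "y < f v" by (auto simp: not_le)
    have I': "I \<subseteq> {a..b}" using I p q \<open>a < x\<close> \<open>x < b\<close> by auto
    then have "u \<in> A" "v \<in> B" using uv by (auto simp: A_def B_def)
    then obtain z where z: "z \<in> C" "z \<in> {min u v..max u v}" using meet by blast
    then have "dist z x < e" "z \<noteq> x"
      using I uv(1,2) p q by (auto simp: dist_real_def)
    then show False using e(2) z by blast
  qed
  \<comment> \<open>\<open>x\<close> is a limit of points of \<open>A\<close> and of
    \<open>B\<close>, so neither weak sign prevails on all of \<open>[p, q]\<close>.\<close>
  have no_same: "\<not> (\<forall>t\<in>{p..q}. f t \<le> y)" "\<not> (\<forall>t\<in>{p..q}. y \<le> f t)"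
  proof -
    have pq: "ball x (min (x - p) (q - x)) \<subseteq> {p..q}" "min (x - p) (q - x) > 0"
      using p q by (auto simp: dist_real_def)
    show "\<not> (\<forall>t\<in>{p..q}. f t \<le> y)"
    proof
      assume *: "\<forall>t\<in>{p..q}. f t \<le> y"
      have "x \<in> closure B" using x by (simp add: C_def)
      then obtain z where "z \<in> B" "dist z x < min (x - p) (q - x)" using pq(2) closure_approachable by blast
      then show False using pq(1) * by (force simp: B_def dist_commute)
    qed
    show "\<not> (\<forall>t\<in>{p..q}. y \<le> f t)"
    proof
      assume *: "\<forall>t\<in>{p..q}. y \<le> f t"
      have "x \<in> closure A" using x by (simp add: C_def)
      then obtain z where "z \<in> A" "dist z x < min (x - p) (q - x)" using pq(2) closure_approachable by blast
      then show False using pq(1) * by (force simp: A_def dist_commute)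
    qed
  qed
  have split: "t \<in> {p..<x} \<or> t = x \<or> t \<in> {x<..q}" if "t \<in> {p..q}" for t using that by auto
  have "(\<forall>t\<in>{p..<x}. f t \<le> y) \<and> (\<forall>t\<in>{x<..q}. y \<le> f t) \<or>
      (\<forall>t\<in>{p..<x}. y \<le> f t) \<and> (\<forall>t\<in>{x<..q}. f t \<le> y)"
    using one_side[of "{p..<x}"] one_side[of "{x<..q}"] no_same split fx(1)
    by (metis order_refl)
  then have "x \<in> crossing f p q \<union> crossing (\<lambda>t. - f t) p q"
  proof
    assume *: "(\<forall>t\<in>{p..<x}. f t \<le> y) \<and> (\<forall>t\<in>{x<..q}. y \<le> f t)"
    have "x \<in> crossing f p q"
      unfolding crossing_def using p q * fx(1) by (auto simp: le_less)
    then show ?thesis by blast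
  next
    assume *: "(\<forall>t\<in>{p..<x}. y \<le> f t) \<and> (\<forall>t\<in>{x<..q}. f t \<le> y)"
    have "x \<in> crossing (\<lambda>t. - f t) p q"
      unfolding crossing_def using p q * fx(1) by (auto simp: le_less)
    then show ?thesis by blast
  qed
  with p(1) q(1) \<open>a < x\<close> \<open>x < b\<close> fx(1) show ?thesis using that by blast
qed

section \<open>Trimness\<close>

lemma lebesgue_outer_eq_emeasure:
  assumes "E \<in> sets lebesgue"
  shows "lebesgue_outer E = emeasure lebesgue E"
  unfolding lebesgue_outer_def
proof (rule antisym)
  show "(INF A \<in> {A \<in> sets lebesgue. E \<subseteq> A}. emeasure lebesgue A) \<le> emeasure lebesgue E"
    by (rule INF_lower) (use assms in auto)
  show "emeasure lebesgue E \<le> (INF A \<in> {A \<in> sets lebesgue. E \<subseteq> A}. emeasure lebesgue A)"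
    by (rule INF_greatest) (use emeasure_mono in blast)
qed

lemma gdelta_imp_borel:
  fixes E :: "real set"
  assumes "gdelta_in euclideanreal E"
  shows "E \<in> sets borel"
proof -
  obtain C :: "nat \<Rightarrow> real set" where "\<And>n. open (C n)" "\<Inter> (range C) = E"
    using assms unfolding gdelta_in_descending by auto
  moreover have "(\<Inter>n. C n) \<in> sets borel" using calculation by (intro sets.countable_INT) auto
  ultimately show ?thesis by simp
qed

section \<open>Images, fibres and the trimness of \<open>L_inf f\<close>\<close>

lemma L_inf_uminus: "L_inf (\<lambda>t. - f t) = L_inf f"
proof -
  have "\<bar>- f x - - f y\<bar> = \<bar>f x - f y\<bar>" for x y by simp
  then show ?thesis unfolding set_eq_iff in_L_inf_iff by simp
qed

lemma UN_scaled_osc_le: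
  assumes "l_inf f = {}"
  shows "(\<Union>n::nat. scaled_osc_le f (real n)) = UNIV"
  using not_in_l_infD[of _ f] assms by (auto simp: scaled_osc_le_def)

lemma negligible_image_l_inf_empty:
  assumes "l_inf f = {}" "negligible Z"
  shows "negligible (f ` Z)"
proof -
  have "Z = (\<Union>n::nat. Z \<inter> scaled_osc_le f (real n))" using UN_scaled_osc_le[OF assms(1)] by blast
  then have "f ` Z = (\<Union>n::nat. f ` (Z \<inter> scaled_osc_le f (real n)))" by (metis image_UN)
  moreover have "negligible (f ` (Z \<inter> scaled_osc_le f (real n)))" for n
    by (rule negligible_image_scaled_osc_le[of _ _ "real n"]) (use assms in \<open>auto intro: negligible_subset\<close>)
  ultimately show ?thesis by (metis negligible_Union_nat)
qed

lemma AE_countable_fibre: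
  assumes "l_inf f = {}"
  shows "AE y in lborel. countable {x \<in> {a..b}. f x = y}"
proof -
  have "AE y in lborel. \<forall>n::nat. finite {x \<in> {a..b} \<inter> scaled_osc_le f (real n). f x = y}"
    unfolding AE_all_countable
  proof
    fix n :: nat
    show "AE y in lborel. finite {x \<in> {a..b} \<inter> scaled_osc_le f (real n). f x = y}"
      \<comment> \<open>The covering argument needs a bounded open interval around
        \<open>[a, b]\<close>.\<close>
      by (rule AE_finite_fibre_scaled_osc_le[of _ _ "real n" "a - 1" "b + 1"]) auto
  qed
  then show ?thesis
  proof eventually_elim
    fix y assume fin: "\<forall>n::nat. finite {x \<in> {a..b} \<inter> scaled_osc_le f (real n). f x = y}"
    have "{x \<in> {a..b}. f x = y} = (\<Union>n::nat. {x \<in> {a..b} \<inter> scaled_osc_le f (real n). f x = y})"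
      using UN_scaled_osc_le[OF assms] by blast
    also have "countable \<dots>" using fin by (intro countable_UN) (auto intro: countable_finite)
    finally show "countable {x \<in> {a..b}. f x = y}" .
  qed
qed

text \<open>If the points of finite \<open>Lip\<close> were null, every value between
  \<open>f a\<close> and \<open>f b\<close> would fall into one of three null sets: the values with
  uncountable fibre, the image of those points, and the images of the crossing points with infinite
  \<open>Lip\<close>.\<close>

lemma not_negligible_finite_Lip_aux:
  assumes cont: "continuous_on UNIV f" and l: "l_inf f = {}" and "a < b" "f a < f b"
  shows "\<not> negligible ({a<..<b} - L_inf f)"
proof
  assume neg: "negligible ({a<..<b} - L_inf f)"
  define N where "N = {y. \<not> countable {x \<in> {a..b}. f x = y}}"
  define X where "X p q = L_inf f \<inter> (crossing f p q \<union> crossing (\<lambda>t. - f t) p q)" for p q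
  have "negligible N"
    using AE_countable_fibre[OF l, of a b, THEN AE_completion]
    unfolding N_def negligible_iff_null_sets eventually_ae_filter
    by (force intro: null_sets_completion_subset simp: completion.complete2)
  moreover have "negligible (X p q)" for p q
  proof -
    have "negligible (L_inf f \<inter> crossing f p q)" using negligible_L_inf_crossing[OF cont] .
    moreover have "negligible (L_inf (\<lambda>t. - f t) \<inter> crossing (\<lambda>t. - f t) p q)"
      by (intro negligible_L_inf_crossing continuous_intros cont)
    ultimately show ?thesis by (simp add: X_def L_inf_uminus Int_Un_distrib)
  qed
  then have "negligible (f ` X p q)" for p q
    using negligible_image_l_inf_empty[OF l] by blast
  then have "negligible (\<Union>(p, q)\<in>\<rat> \<times> \<rat>. f ` X p q)"
    by (intro negligible_countable_Union countable_image countable_SIGMA countable_rat) auto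
  moreover have "negligible (f ` ({a<..<b} - L_inf f))"
    using negligible_image_l_inf_empty[OF l neg] .
  moreover have "{f a<..<f b} \<subseteq> N \<union> f ` ({a<..<b} - L_inf f) \<union> (\<Union>(p, q)\<in>\<rat> \<times> \<rat>. f ` X p q)"
  proof
    fix y assume y: "y \<in> {f a<..<f b}"
    show "y \<in> N \<union> f ` ({a<..<b} - L_inf f) \<union> (\<Union>(p, q)\<in>\<rat> \<times> \<rat>. f ` X p q)"
    proof (cases "y \<in> N")
      case False
      then have "countable {x \<in> {a..b}. f x = y}" by (simp add: N_def)
      then obtain x p q where "p \<in> \<rat>" "q \<in> \<rat>" "a < x" "x < b" "f x = y"
        "x \<in> crossing f p q \<union> crossing (\<lambda>t. - f t) p q"
        by (rule crossing_of_countable_fibre[OF cont \<open>a < b\<close>, of y, rotated 2]) (use y in auto)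
      then show ?thesis by (cases "x \<in> L_inf f") (auto simp: X_def)
    qed simp
  qed
  ultimately have "negligible {f a<..<f b}"
    by (meson negligible_Un negligible_subset)
  moreover have "\<not> negligible {f a<..<f b}"
    using \<open>f a < f b\<close> by (intro open_not_negligible) auto
  ultimately show False by blast
qed

text \<open>A subinterval with different end values reduces the claim to the auxiliary lemma for
  \<open>f\<close> or \<open>- f\<close>; if there is none, \<open>f\<close> is constant on
  \<open>(a, b)\<close>.\<close>

lemma not_negligible_finite_Lip:
  assumes cont: "continuous_on UNIV f" and l: "l_inf f = {}" and "a < b"
  shows "\<not> negligible ({a<..<b} - L_inf f)"
proof (cases "\<exists>u v. a < u \<and> u < v \<and> v < b \<and> f u \<noteq> f v")
  case True
  then obtain u v where uv: "a < u" "u < v" "v < b" "f u \<noteq> f v" by blast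
  have "\<not> negligible ({u<..<v} - L_inf f)"
  proof (cases "f u < f v")
    case True
    then show ?thesis using not_negligible_finite_Lip_aux[OF cont l] uv by blast
  next
    case False
    have "Mf (\<lambda>t. - f t) = Mf f"
    proof (intro ext)
      fix x r
      have "\<bar>- f x - - f y\<bar> = \<bar>f x - f y\<bar>" for y by simp
      then show "Mf (\<lambda>t. - f t) x r = Mf f x r" unfolding Mf_def by simp
    qed
    then have "l_inf (\<lambda>t. - f t) = {}" using l by (simp add: l_inf_def lip_lower_def)
    moreover have "continuous_on UNIV (\<lambda>t. - f t)" by (intro continuous_intros cont)
    ultimately have "\<not> negligible ({u<..<v} - L_inf (\<lambda>t. - f t))"
      using not_negligible_finite_Lip_aux[of "\<lambda>t. - f t" u v] uv False by auto
    then show ?thesis by (simp add: L_inf_uminus)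
  qed
  moreover have "{u<..<v} - L_inf f \<subseteq> {a<..<b} - L_inf f" using uv by auto
  ultimately show ?thesis using negligible_subset by blast
next
  case False
  have "x \<notin> L_inf f" if x: "x \<in> {a<..<b}" for x
    unfolding not_in_L_inf_iff
  proof (rule exI[of _ 0], rule exI[of _ "min (x - a) (b - x)"], intro conjI allI impI)
    fix y assume "\<bar>x - y\<bar> < min (x - a) (b - x)"
    then have "a < y" "y < b" by auto
    then have "f x = f y" using False x by (metis greaterThanLessThan_iff linorder_neqE_linordered_idom)
    then show "\<bar>f x - f y\<bar> \<le> 0 * \<bar>x - y\<bar>" by simp
  qed (use x in auto)
  then have "{a<..<b} - L_inf f = {a<..<b}" by blast
  then show ?thesis using \<open>a < b\<close> open_not_negligible[of "{a<..<b}"] by auto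
qed

text \<open>Additivity of measure, with the finite measure of \<open>E \<inter> {a<..<b}\<close>
  cancelled. Both directions of the theorem use trimness in this complementary form.\<close>

lemma trim_iff_not_negligible:
  assumes "E \<in> sets borel"
  shows "trim E \<longleftrightarrow> (\<forall>a b. a < b \<longrightarrow> \<not> negligible ({a<..<b} - E))"
  unfolding trim_def
proof (intro all_cong1 imp_cong refl)
  fix a b :: real assume "a < b"
  have meas [measurable]: "E \<in> sets lebesgue" using assms by simp
  have "emeasure lebesgue {a<..<b} = emeasure lebesgue (E \<inter> {a<..<b}) + emeasure lebesgue ({a<..<b} - E)"
  proof (subst plus_emeasure)
    have "E \<inter> {a<..<b} \<union> ({a<..<b} - E) = {a<..<b}" by blast
    then show "emeasure lebesgue {a<..<b} = emeasure lebesgue (E \<inter> {a<..<b} \<union> ({a<..<b} - E))" by simp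
  qed auto
  then have sum: "ennreal (b - a) = emeasure lebesgue (E \<inter> {a<..<b}) + emeasure lebesgue ({a<..<b} - E)"
    using \<open>a < b\<close> by simp
  have "lebesgue_outer (E \<inter> {a<..<b}) = emeasure lebesgue (E \<inter> {a<..<b})"
    using meas by (intro lebesgue_outer_eq_emeasure sets.Int) auto
  moreover have "negligible ({a<..<b} - E) \<longleftrightarrow> emeasure lebesgue ({a<..<b} - E) = 0"
  proof -
    have "{a<..<b} - E \<in> sets lebesgue" using meas by (intro sets.Diff) auto
    then show ?thesis by (simp add: negligible_iff_null_sets null_sets_def)
  qed
  moreover have "x < x + y \<longleftrightarrow> y \<noteq> 0" if "x \<noteq> top" for x y :: ennreal
    using that by (cases x; cases y) (auto simp: ennreal_plus[symmetric] ennreal_less_iff simp del: ennreal_plus)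
  moreover have "emeasure lebesgue (E \<inter> {a<..<b}) \<noteq> top"
    using sum by (metis ennreal_add_eq_top ennreal_neq_top)
  ultimately show "lebesgue_outer (E \<inter> {a<..<b}) < ennreal (b - a) \<longleftrightarrow> \<not> negligible ({a<..<b} - E)"
    using sum by simp
qed

lemma trim_L_inf:
  assumes "continuous_on UNIV f" "l_inf f = {}"
  shows "trim (L_inf f)"
  using trim_iff_not_negligible[OF gdelta_imp_borel[OF gdelta_L_inf[OF assms(1)]]]
    not_negligible_finite_Lip[OF assms] by blast

section \<open>Oscillating functions that are locally constant on a trim set\<close>

text \<open>The height is prescribed exactly while the Lipschitz constant is left free, because only
  its finiteness matters later.\<close>

lemma trim_bump:
  fixes E :: "real set" and H :: real
  assumes E: "E \<in> sets borel" "trim E" and "a < b" "H > 0"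
  shows "\<exists>g. (\<exists>L. L-lipschitz_on UNIV g) \<and> (\<forall>x. x \<notin> {a<..<b} \<longrightarrow> g x = 0) \<and> (\<forall>x. 0 \<le> g x \<and> g x \<le> H)
    \<and> (\<exists>z. g z = H) \<and> (\<forall>x\<in>E. \<forall>\<^sub>F y in nhds x. g y = g x)"
proof -
  define A where "A = {a<..<b} - E"
  have Al: "A \<in> lmeasurable"
    unfolding A_def by (rule fmeasurable_Diff) (use E in auto)
  have "\<not> negligible A" unfolding A_def using trim_iff_not_negligible[OF E(1)] E(2) \<open>a < b\<close> by blast
  then have Apos: "measure lebesgue A > 0"
    using Al by (simp add: negligible_iff_measure zero_less_measure_iff)
  \<comment> \<open>An inner approximation with error below the measure of \<open>A\<close> itself
    forces \<open>K\<close> to have positive measure.\<close>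
  obtain K where K: "closed K" "K \<subseteq> A" "A - K \<in> lmeasurable" "emeasure lebesgue (A - K) < ennreal (measure lebesgue A)"
    using sets_lebesgue_inner_closed[OF fmeasurableD[OF Al] Apos] by blast
  have KE: "K \<subseteq> {a<..<b}" "K \<inter> E = {}" using K(2) by (auto simp: A_def)
  have "K \<subseteq> {a..b}" using KE by force
  then have Kl: "K \<in> lmeasurable"
    using K(1) by (intro lmeasurable_compact) (meson bounded_closed_interval bounded_subset compact_eq_bounded_closed)
  define \<mu> where "\<mu> = measure lebesgue K"
  have \<mu>: "\<mu> > 0"
  proof -
    have "measure lebesgue (A - K) = measure lebesgue A - \<mu>"
      unfolding \<mu>_def by (rule measurable_measure_Diff) (use Al Kl K(2) in auto)
    moreover have "measure lebesgue (A - K) < measure lebesgue A"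
      using K(3,4) by (simp add: emeasure_eq_measure2 ennreal_less_iff)
    ultimately show ?thesis by linarith
  qed
  define \<phi> where "\<phi> x = measure lebesgue (K \<inter> {..x})" for x
  have Kx: "K \<inter> {..x} \<in> lmeasurable" for x
    using Kl by (intro fmeasurable_Int_fmeasurable) auto
  have mono: "\<phi> x \<le> \<phi> y" if "x \<le> y" for x y
    unfolding \<phi>_def by (rule measure_mono_fmeasurable) (use that Kx in auto)
  have incr: "\<phi> y \<le> \<phi> x + (y - x)" if "x \<le> y" for x y
  proof -
    have "\<phi> y \<le> measure lebesgue ((K \<inter> {..x}) \<union> {x..y})"
      unfolding \<phi>_def by (rule measure_mono_fmeasurable) (use Kx in \<open>auto intro!: fmeasurable.Un\<close>)
    also have "\<dots> \<le> \<phi> x + measure lebesgue {x..y}"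
      unfolding \<phi>_def by (rule measure_Un_le) (use Kx in auto)
    finally show ?thesis using that by simp
  qed
  have \<phi>lip: "\<bar>\<phi> x - \<phi> y\<bar> \<le> \<bar>x - y\<bar>" for x y
    using mono[of x y] mono[of y x] incr[of x y] incr[of y x] by (cases "x \<le> y") auto
  have \<phi>0: "\<phi> x = 0" if "x \<le> a" for x
  proof -
    have "K \<inter> {..x} = {}" using KE that by auto
    then show ?thesis by (simp add: \<phi>_def)
  qed
  have \<phi>1: "\<phi> x = \<mu>" if "b \<le> x" for x
  proof -
    have "K \<inter> {..x} = K" using KE that by auto
    then show ?thesis by (simp add: \<phi>_def \<mu>_def)
  qed
  have \<phi>b: "0 \<le> \<phi> x" "\<phi> x \<le> \<mu>" for x
    unfolding \<phi>_def \<mu>_def by (simp, rule measure_mono_fmeasurable) (use Kl Kx in auto)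
  \<comment> \<open>Zero where \<open>\<phi>\<close> is \<open>0\<close> or \<open>\<mu>\<close>,
    hence off \<open>(a, b)\<close>, and equal to \<open>H\<close> where \<open>\<phi>\<close> is
    \<open>\<mu> / 2\<close>.\<close>
  define g where "g x = H * (1 - \<bar>2 * \<phi> x / \<mu> - 1\<bar>)" for x
  have "continuous_on {a..b} \<phi>"
  proof -
    have "1-lipschitz_on UNIV \<phi>" by (rule lipschitz_onI) (auto simp: dist_real_def \<phi>lip)
    then show ?thesis using continuous_on_subset lipschitz_on_continuous_on by blast
  qed
  then obtain z where z: "\<phi> z = \<mu> / 2"
    using IVT'[of \<phi> a "\<mu> / 2" b] \<phi>0[of a] \<phi>1[of b] \<mu> \<open>a < b\<close> by auto
  show ?thesis
  proof (intro exI[of _ g] conjI allI impI ballI)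
    have "(2 * H / \<mu>)-lipschitz_on UNIV g"
    proof (rule lipschitz_onI)
      fix x y
      have "\<bar>g x - g y\<bar> = H * \<bar>\<bar>2 * \<phi> y / \<mu> - 1\<bar> - \<bar>2 * \<phi> x / \<mu> - 1\<bar>\<bar>"
        using \<open>H > 0\<close> by (simp add: g_def abs_mult right_diff_distrib[symmetric])
      also have "\<dots> \<le> H * \<bar>2 * \<phi> y / \<mu> - 2 * \<phi> x / \<mu>\<bar>"
        using \<open>H > 0\<close> by (intro mult_left_mono) linarith+
      also have "\<dots> = 2 * H / \<mu> * \<bar>\<phi> x - \<phi> y\<bar>"
      proof -
        have "2 * \<phi> y / \<mu> - 2 * \<phi> x / \<mu> = - (2 / \<mu> * (\<phi> x - \<phi> y))" using \<mu> by (simp add: field_simps)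
        then have "\<bar>2 * \<phi> y / \<mu> - 2 * \<phi> x / \<mu>\<bar> = 2 / \<mu> * \<bar>\<phi> x - \<phi> y\<bar>"
          using \<mu> by (simp only: abs_minus_cancel abs_mult) simp
        then show ?thesis by (simp only: mult.assoc[symmetric]) simp
      qed
      also have "\<dots> \<le> 2 * H / \<mu> * \<bar>x - y\<bar>"
        using \<mu> \<open>H > 0\<close> by (intro mult_left_mono \<phi>lip) auto
      finally show "dist (g x) (g y) \<le> 2 * H / \<mu> * dist x y" by (simp add: dist_real_def)
    qed (use \<mu> \<open>H > 0\<close> in auto)
    then show "\<exists>L. L-lipschitz_on UNIV g" by blast
    show "g x = 0" if "x \<notin> {a<..<b}" for x
      using that \<phi>0[of x] \<phi>1[of x] \<mu> by (cases "x \<le> a") (auto simp: g_def)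
    have "\<bar>2 * \<phi> x / \<mu> - 1\<bar> \<le> 1" for x
      using \<phi>b[of x] \<mu> by (simp add: abs_le_iff field_simps)
    then show "0 \<le> g x" "g x \<le> H" for x
      using \<open>H > 0\<close> by (auto simp: g_def mult_le_cancel_left1)
    show "\<exists>z. g z = H" using z \<mu> by (intro exI[of _ z]) (simp add: g_def)
    fix x assume "x \<in> E"
    then have "x \<in> - K" "open (- K)" using KE K(1) by auto
    then obtain d where d: "d > 0" "ball x d \<subseteq> - K" using open_contains_ball by blast
    \<comment> \<open>Moving inside a ball that misses \<open>K\<close> collects no mass of
      \<open>K\<close>.\<close>
    have "\<phi> y = \<phi> x" if "\<bar>x - y\<bar> < d" for y
    proof -
      have "k \<le> y \<longleftrightarrow> k \<le> x" if "k \<in> K" for k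
      proof -
        have "\<not> \<bar>x - k\<bar> < d" using d(2) that by (auto simp: dist_real_def)
        then show ?thesis using \<open>\<bar>x - y\<bar> < d\<close> by linarith
      qed
      then have "K \<inter> {..y} = K \<inter> {..x}" by auto
      then show ?thesis by (simp add: \<phi>_def)
    qed
    then show "\<forall>\<^sub>F y in nhds x. g y = g x"
      unfolding eventually_nhds_metric
    proof (intro exI[of _ d] conjI allI impI d(1))
      fix y assume *: "\<And>y. \<bar>x - y\<bar> < d \<Longrightarrow> \<phi> y = \<phi> x" "dist y x < d"
      then have "\<phi> y = \<phi> x" by (intro *(1)) (simp add: dist_real_def abs_minus_commute)
      then show "g y = g x" by (simp add: g_def)
    qed
  qed
qed

section \<open>Stability of the condition that \<open>Lip\<close> is finite\<close>

lemma not_in_L_inf_imp_isCont: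
  assumes "x \<notin> L_inf f"
  shows "isCont f x"
proof -
  obtain C \<delta> where *: "\<delta> > 0" "\<And>y. \<bar>x - y\<bar> < \<delta> \<Longrightarrow> \<bar>f x - f y\<bar> \<le> C * \<bar>x - y\<bar>"
    using assms unfolding not_in_L_inf_iff by blast
  have "((\<lambda>y. C * \<bar>x - y\<bar>) \<longlongrightarrow> C * \<bar>x - x\<bar>) (at x)" by (intro tendsto_intros)
  then have "((\<lambda>y. C * \<bar>x - y\<bar>) \<longlongrightarrow> 0) (at x)" by simp
  moreover have "\<forall>\<^sub>F y in at x. norm (f y - f x) \<le> C * \<bar>x - y\<bar>"
    unfolding eventually_at using * by (intro exI[of _ \<delta>]) (auto simp: dist_real_def abs_minus_commute)
  ultimately have "((\<lambda>y. f y - f x) \<longlongrightarrow> 0) (at x)"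
    by (rule Lim_null_comparison[rotated])
  then show ?thesis unfolding isCont_def using LIM_zero_cancel by blast
qed

lemma not_in_L_inf_add:
  assumes "x \<notin> L_inf f" "x \<notin> L_inf g"
  shows "x \<notin> L_inf (\<lambda>t. f t + g t)"
proof -
  obtain C \<delta> where 1: "\<delta> > 0" "\<And>y. \<bar>x - y\<bar> < \<delta> \<Longrightarrow> \<bar>f x - f y\<bar> \<le> C * \<bar>x - y\<bar>"
    using assms(1) unfolding not_in_L_inf_iff by blast
  obtain D \<eta> where 2: "\<eta> > 0" "\<And>y. \<bar>x - y\<bar> < \<eta> \<Longrightarrow> \<bar>g x - g y\<bar> \<le> D * \<bar>x - y\<bar>"
    using assms(2) unfolding not_in_L_inf_iff by blast
  have "\<bar>f x + g x - (f y + g y)\<bar> \<le> (C + D) * \<bar>x - y\<bar>" if "\<bar>x - y\<bar> < min \<delta> \<eta>" for y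
    using 1(2)[of y] 2(2)[of y] that by (simp add: distrib_right)
  moreover have "min \<delta> \<eta> > 0" using 1 2 by simp
  ultimately show ?thesis unfolding not_in_L_inf_iff by blast
qed

lemma not_in_L_inf_sum:
  assumes "\<And>i. i \<in> I \<Longrightarrow> x \<notin> L_inf (f i)"
  shows "x \<notin> L_inf (\<lambda>t. \<Sum>i\<in>I. f i t)"
proof -
  have zero: "x \<notin> L_inf (\<lambda>t. 0)"
    unfolding not_in_L_inf_iff by (intro exI[of _ 0] exI[of _ 1]) auto
  show ?thesis
  proof (cases "finite I")
    case True
    then show ?thesis using assms
      by (induction I rule: finite_induct) (simp_all add: zero not_in_L_inf_add)
  qed (simp add: zero)
qed

lemma not_in_L_inf_cong:
  assumes "x \<notin> L_inf g" "\<forall>\<^sub>F y in nhds x. f y = g y"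
  shows "x \<notin> L_inf f"
proof -
  obtain C \<delta> where 1: "\<delta> > 0" "\<And>y. \<bar>x - y\<bar> < \<delta> \<Longrightarrow> \<bar>g x - g y\<bar> \<le> C * \<bar>x - y\<bar>"
    using assms(1) unfolding not_in_L_inf_iff by blast
  obtain d where d: "d > 0" "\<And>y. dist y x < d \<Longrightarrow> f y = g y"
    using assms(2) unfolding eventually_nhds_metric by blast
  have "\<bar>f x - f y\<bar> \<le> C * \<bar>x - y\<bar>" if "\<bar>x - y\<bar> < min \<delta> d" for y
    using 1(2)[of y] d(2)[of y] d(2)[of x] that d(1) by (simp add: dist_real_def abs_minus_commute)
  moreover have "min \<delta> d > 0" using 1 d by simp
  ultimately show ?thesis unfolding not_in_L_inf_iff by blast
qed

lemma lipschitz_not_in_L_inf: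
  assumes "L-lipschitz_on UNIV g"
  shows "x \<notin> L_inf g"
  unfolding not_in_L_inf_iff
  using lipschitz_onD[OF assms] by (intro exI[of _ L] exI[of _ 1]) (auto simp: dist_real_def)

text \<open>The hypothesis forces \<open>f x = 0\<close>, and a square is at most linear within
  distance \<open>1\<close>. This settles the points outside the open set on which a term, or a tail
  of the series, lives.\<close>

lemma quadratic_bound_not_in_L_inf:
  assumes "\<And>y. \<bar>f y\<bar> \<le> e * (y - x)\<^sup>2" "e \<ge> 0"
  shows "x \<notin> L_inf f"
  unfolding not_in_L_inf_iff
proof (rule exI[of _ e], rule exI[of _ 1], intro conjI allI impI)
  fix y assume y: "\<bar>x - y\<bar> < 1"
  have "f x = 0" using assms(1)[of x] by simp
  then have "\<bar>f x - f y\<bar> \<le> e * (y - x)\<^sup>2" using assms(1)[of y] by simp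
  also have "(y - x)\<^sup>2 = \<bar>x - y\<bar> * \<bar>x - y\<bar>" by (metis abs_minus_commute power2_abs power2_eq_square)
  also have "\<dots> \<le> \<bar>x - y\<bar> * 1" by (intro mult_left_mono) (use y in auto)
  finally show "\<bar>f x - f y\<bar> \<le> e * \<bar>x - y\<bar>" using assms(2) by (simp add: mult_left_mono)
qed simp

text \<open>Otherwise the level set of \<open>f z\<close> would be clopen in the segment without
  containing \<open>x\<close>. Keeping the value \<open>f z\<close> preserves the whole increment
  from \<open>x\<close>.\<close>

lemma exists_not_locally_constant:
  fixes f :: "real \<Rightarrow> real"
  assumes "continuous_on UNIV f" "f x \<noteq> f z"
  obtains y where "y \<in> {min x z..max x z}" "f y = f z" "\<not> (\<forall>\<^sub>F t in nhds y. f t = f y)"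
proof -
  define S where "S = {min x z..max x z}"
  have "\<exists>y\<in>S. f y = f z \<and> \<not> (\<forall>\<^sub>F t in nhds y. f t = f y)"
  proof (rule ccontr)
    assume *: "\<not> ?thesis"
    define T where "T = {t \<in> S. f t = f z}"
    have "closedin (top_of_set S) T"
      unfolding T_def using assms(1) continuous_on_subset
      by (intro continuous_closedin_preimage_constant) blast
    moreover have "openin (top_of_set S) T"
    proof -
      have "\<exists>e>0. \<forall>t\<in>S. dist t y < e \<longrightarrow> t \<in> T" if "y \<in> T" for y
      proof -
        have "\<forall>\<^sub>F t in nhds y. f t = f y" using * that by (auto simp: T_def)
        then show ?thesis using that unfolding eventually_nhds_metric by (auto simp: T_def)
      qed
      then show ?thesis unfolding openin_euclidean_subtopology_iff by (auto simp: T_def)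
    qed
    moreover have "connected S" by (simp add: S_def)
    ultimately have "T = {} \<or> T = S" unfolding connected_clopen by blast
    moreover have "z \<in> T" "x \<in> S" "x \<notin> T" using assms(2) by (auto simp: T_def S_def)
    ultimately show False by blast
  qed
  then show ?thesis using that by (auto simp: S_def)
qed

text \<open>Integer division by a power of two passes from the index of a dyadic cell to that of its
  ancestor at a coarser level.\<close>

lemma floor_times_power2_div:
  fixes x :: real
  assumes "m' \<le> m"
  shows "\<lfloor>x * 2 ^ m'\<rfloor> = \<lfloor>x * 2 ^ m\<rfloor> div 2 ^ (m - m')"
proof -
  have "(2::real) ^ m = 2 ^ m' * 2 ^ (m - m')" using assms by (simp flip: power_add)
  then have "x * 2 ^ m' = x * 2 ^ m / real_of_int (2 ^ (m - m'))" by simp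
  then show ?thesis using floor_divide_real_eq_div[of "2 ^ (m - m')" "x * 2 ^ m"] by simp
qed

text \<open>Each function of the series lives on the maximal dyadic cells of \<open>U\<close> whose length is
  small compared with the squared distance to the complement of \<open>U\<close>; on a cell it is a single bump
  whose height is \<open>2 N\<close> times the length of the cell.\<close>

lemma oscillating_step:
  fixes E U :: "real set" and N e :: real
  assumes E: "E \<in> sets borel" "trim E" and "open U" "N > 0" "e > 0"
  shows "\<exists>f. (\<forall>x. x \<notin> L_inf f) \<and> (\<forall>x. \<bar>f x\<bar> \<le> e) \<and> (\<forall>x y. y \<notin> U \<longrightarrow> \<bar>f x\<bar> \<le> e * (x - y)\<^sup>2)
    \<and> (\<forall>x\<in>E \<inter> U. \<forall>\<^sub>F y in nhds x. f y = f x)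
    \<and> (\<forall>x\<in>U. \<exists>z. \<bar>x - z\<bar> \<le> 1 / N \<and> {min x z..max x z} \<subseteq> U \<and> f x \<noteq> f z \<and> N * \<bar>x - z\<bar> \<le> \<bar>f x - f z\<bar>)"
proof -
  define lo where "lo m k = real_of_int k / 2 ^ m" for m :: nat and k :: int
  define hi where "hi m k = (real_of_int k + 1) / 2 ^ m" for m :: nat and k :: int
  \<comment> \<open>The factor \<open>2\<close> compensates for the fact that the increment
    available from a given point may be only half the height.\<close>
  define H where "H m = 2 * N / 2 ^ m" for m :: nat
  have H: "H m > 0" for m using \<open>N > 0\<close> by (simp add: H_def)
  have lohi: "lo m k < hi m k" "hi m k - lo m k = 1 / 2 ^ m" for m k
    by (auto simp: lo_def hi_def field_simps)
  have cell: "\<lfloor>x * 2 ^ m\<rfloor> = k \<longleftrightarrow> lo m k \<le> x \<and> x < hi m k" for x m k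
    by (simp add: floor_eq_iff lo_def hi_def field_simps)
  then have own: "lo m \<lfloor>x * 2 ^ m\<rfloor> \<le> x" "x < hi m \<lfloor>x * 2 ^ m\<rfloor>" for x m by blast+
  \<comment> \<open>The three conditions prepare, in this order, the uniform bound, the distance to
    the witness \<open>z\<close> and the quadratic bound of the conclusion.\<close>
  define good where "good m k \<longleftrightarrow> H m \<le> e \<and> 1 / 2 ^ m \<le> 1 / N \<and>
    (\<forall>x\<in>{lo m k..hi m k}. \<forall>y. y \<notin> U \<longrightarrow> H m \<le> e * (x - y)\<^sup>2)" for m k
  \<comment> \<open>No dyadic ancestor is good; this maximality makes the chosen cells
    disjoint.\<close>
  define chosen where "chosen m k \<longleftrightarrow> good m k \<and> (\<forall>m'<m. \<not> good m' (k div 2 ^ (m - m')))" for m k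
  define lev where "lev x = (LEAST m. good m \<lfloor>x * 2 ^ m\<rfloor>)" for x :: real
  have small: "\<exists>M. H M \<le> c \<and> 1 / 2 ^ M \<le> c" if "c > 0" for c
  proof -
    obtain M where M: "(1 / 2) ^ M < min c (c / (2 * N))"
      using real_arch_pow_inv[of "min c (c / (2 * N))" "1 / 2"] \<open>c > 0\<close> \<open>N > 0\<close> by auto
    then have "1 / 2 ^ M \<le> c / (2 * N)" "1 / 2 ^ M \<le> c" by (auto simp: power_one_over)
    moreover from this(1) have "H M \<le> c" using \<open>N > 0\<close> by (simp add: H_def field_simps)
    ultimately show ?thesis by blast
  qed
  have local_good: "\<exists>\<rho>>0. \<exists>M. \<forall>x. \<bar>x - x0\<bar> < \<rho> \<longrightarrow> x \<in> U \<and> good M \<lfloor>x * 2 ^ M\<rfloor>" if "x0 \<in> U" for x0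
  proof -
    obtain \<rho> where \<rho>: "\<rho> > 0" "ball x0 \<rho> \<subseteq> U" using openE[OF \<open>open U\<close> \<open>x0 \<in> U\<close>] by blast
    \<comment> \<open>A cell reaches at most \<open>\<rho> / 4\<close> beyond \<open>x\<close>,
      which is within \<open>\<rho> / 2\<close> of \<open>x0\<close>; distance
      \<open>\<rho> / 4\<close> to the complement of \<open>U\<close> remains.\<close>
    define c where "c = min (min e (1 / N)) (min (\<rho> / 4) (e * (\<rho> / 4)\<^sup>2))"
    have c: "c > 0" using \<rho>(1) \<open>e > 0\<close> \<open>N > 0\<close> by (simp add: c_def)
    have c': "c \<le> e" "c \<le> 1 / N" "c \<le> \<rho> / 4" "c \<le> e * (\<rho> / 4)\<^sup>2"
      unfolding c_def by linarith+
    obtain M where "H M \<le> c" "1 / 2 ^ M \<le> c" using small[OF c] by blast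
    then have M: "H M \<le> e" "H M \<le> e * (\<rho> / 4)\<^sup>2" "1 / 2 ^ M \<le> 1 / N" "1 / 2 ^ M \<le> \<rho> / 4"
      using c' by linarith+
    have "x \<in> U \<and> good M \<lfloor>x * 2 ^ M\<rfloor>" if x: "\<bar>x - x0\<bar> < \<rho> / 2" for x
    proof
      show "x \<in> U" using x \<rho> by (auto simp: dist_real_def abs_minus_commute subset_iff)
      have "H M \<le> e * (t - y)\<^sup>2" if t: "t \<in> {lo M \<lfloor>x * 2 ^ M\<rfloor>..hi M \<lfloor>x * 2 ^ M\<rfloor>}" and "y \<notin> U" for t y
      proof -
        have "lo M \<lfloor>x * 2 ^ M\<rfloor> \<le> x" "x < hi M \<lfloor>x * 2 ^ M\<rfloor>" by (rule own)+
        then have "\<bar>t - x\<bar> \<le> \<rho> / 4"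
          using t M(4) lohi(2)[of M "\<lfloor>x * 2 ^ M\<rfloor>"] unfolding atLeastAtMost_iff by linarith
        moreover have "\<not> \<bar>x0 - y\<bar> < \<rho>" using \<open>y \<notin> U\<close> \<rho> by (auto simp: dist_real_def)
        ultimately have "\<rho> / 4 \<le> \<bar>t - y\<bar>" using x by linarith
        then have "(\<rho> / 4)\<^sup>2 \<le> (t - y)\<^sup>2" using \<rho>(1) power_mono[of "\<rho> / 4" "\<bar>t - y\<bar>" 2] by simp
        then have "e * (\<rho> / 4)\<^sup>2 \<le> e * (t - y)\<^sup>2" using \<open>e > 0\<close> by simp
        then show ?thesis using M by linarith
      qed
      then show "good M \<lfloor>x * 2 ^ M\<rfloor>" using M by (auto simp: good_def)
    qed
    then show ?thesis using \<rho>(1) by (intro exI[of _ "\<rho> / 2"] conjI exI[of _ M]) auto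
  qed
  have chosen_lev: "chosen (lev x) \<lfloor>x * 2 ^ lev x\<rfloor>" if "x \<in> U" for x
  proof -
    obtain \<rho> M where "\<rho> > 0" "\<forall>t. \<bar>t - x\<bar> < \<rho> \<longrightarrow> t \<in> U \<and> good M \<lfloor>t * 2 ^ M\<rfloor>"
      using local_good[OF \<open>x \<in> U\<close>] by blast
    then have "good M \<lfloor>x * 2 ^ M\<rfloor>" by simp
    then have "good (lev x) \<lfloor>x * 2 ^ lev x\<rfloor>" unfolding lev_def by (rule LeastI)
    moreover have "\<not> good m' (\<lfloor>x * 2 ^ lev x\<rfloor> div 2 ^ (lev x - m'))" if "m' < lev x" for m'
      using not_less_Least[OF that[unfolded lev_def]] floor_times_power2_div[of m' "lev x" x] that by simp
    ultimately show ?thesis by (simp add: chosen_def)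
  qed
  \<comment> \<open>A good cell lies in \<open>U\<close>, since \<open>y = x\<close> would give
    \<open>H m \<le> 0\<close>; having no good ancestor makes \<open>m\<close> the least good level
    at \<open>x\<close>.\<close>
  have chosen_unique: "x \<in> U \<and> lev x = m" if "chosen m \<lfloor>x * 2 ^ m\<rfloor>" for x m
  proof
    have g: "good m \<lfloor>x * 2 ^ m\<rfloor>" using that by (simp add: chosen_def)
    show "x \<in> U"
    proof (rule ccontr)
      assume "x \<notin> U"
      moreover have "x \<in> {lo m \<lfloor>x * 2 ^ m\<rfloor>..hi m \<lfloor>x * 2 ^ m\<rfloor>}" using own[where x = x and m = m] by simp
      ultimately have "H m \<le> e * (x - x)\<^sup>2" using g unfolding good_def by blast
      then show False using H[of m] by simp
    qed
    show "lev x = m" unfolding lev_def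
    proof (rule Least_equality)
      show "good m \<lfloor>x * 2 ^ m\<rfloor>" by (rule g)
      fix m' assume "good m' \<lfloor>x * 2 ^ m'\<rfloor>"
      then have "\<not> m' < m"
        using that floor_times_power2_div[of m' m x] unfolding chosen_def by (metis less_imp_le)
      then show "m \<le> m'" by simp
    qed
  qed
  have "\<exists>g. (\<exists>L. L-lipschitz_on UNIV g) \<and> (\<forall>x. x \<notin> {lo m k<..<hi m k} \<longrightarrow> g x = 0) \<and> (\<forall>x. 0 \<le> g x \<and> g x \<le> H m)
    \<and> (\<exists>z. g z = H m) \<and> (\<forall>x\<in>E. \<forall>\<^sub>F y in nhds x. g y = g x)" for m k
    by (rule trim_bump[OF E lohi(1) H])
  then obtain g where g: "\<And>m k. \<exists>L. L-lipschitz_on UNIV (g m k)"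
    "\<And>m k x. x \<notin> {lo m k<..<hi m k} \<Longrightarrow> g m k x = 0"
    "\<And>m k x. 0 \<le> g m k x \<and> g m k x \<le> H m" "\<And>m k. \<exists>z. g m k z = H m"
    "\<And>m k x. x \<in> E \<Longrightarrow> \<forall>\<^sub>F y in nhds x. g m k y = g m k x"
    by metis
  define f where "f x = (if x \<in> U then g (lev x) \<lfloor>x * 2 ^ lev x\<rfloor> x else 0)" for x
  have f_cell: "x \<in> U \<and> f x = g m k x" if "chosen m k" "lo m k \<le> x" "x < hi m k" for m k x
  proof -
    have k: "k = \<lfloor>x * 2 ^ m\<rfloor>" using cell[of x m k] that by simp
    then show ?thesis using chosen_unique[of m x] that by (auto simp: f_def)
  qed
  \<comment> \<open>Local finiteness: near \<open>x0\<close> the levels are at most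
    \<open>M\<close>, so finitely many bumps suffice.\<close>
  have f_sum: "\<exists>F. finite F \<and> (\<forall>\<^sub>F x in nhds x0. f x = (\<Sum>(m, k)\<in>F. g m k x))" if "x0 \<in> U" for x0
  proof -
    obtain \<rho> M where \<rho>: "\<rho> > 0" "\<And>x. \<bar>x - x0\<bar> < \<rho> \<Longrightarrow> x \<in> U \<and> good M \<lfloor>x * 2 ^ M\<rfloor>"
      using local_good[OF \<open>x0 \<in> U\<close>] by blast
    \<comment> \<open>Bounds the index of every cell of level at most \<open>M\<close> that contains
      a point within \<open>\<rho>\<close> of \<open>x0\<close>.\<close>
    define B where "B = \<lceil>(\<bar>x0\<bar> + \<rho>) * 2 ^ M\<rceil> + 1"
    define F where "F = {(m, k). m \<le> M \<and> - B \<le> k \<and> k \<le> B \<and> chosen m k}"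
    have "F \<subseteq> {..M} \<times> {-B..B}" by (auto simp: F_def)
    then have fin: "finite F" by (rule finite_subset) auto
    have "f x = (\<Sum>(m, k)\<in>F. g m k x)" if x: "\<bar>x - x0\<bar> < \<rho>" for x
    proof -
      let ?c = "(lev x, \<lfloor>x * 2 ^ lev x\<rfloor>)"
      have xU: "x \<in> U" and "good M \<lfloor>x * 2 ^ M\<rfloor>" using \<rho>(2) x by auto
      then have lM: "lev x \<le> M" unfolding lev_def by (intro Least_le)
      have "\<bar>x * 2 ^ lev x\<bar> \<le> (\<bar>x0\<bar> + \<rho>) * 2 ^ M"
        unfolding abs_mult using x lM \<rho>(1) by (intro mult_mono) auto
      then have "- B \<le> \<lfloor>x * 2 ^ lev x\<rfloor>" "\<lfloor>x * 2 ^ lev x\<rfloor> \<le> B" unfolding B_def by linarith+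
      then have cF: "?c \<in> F" using lM chosen_lev[OF xU] by (simp add: F_def)
      have "(\<Sum>c\<in>F. g (fst c) (snd c) x) = (\<Sum>c\<in>{?c}. g (fst c) (snd c) x)"
      proof (rule sum.mono_neutral_right[OF fin])
        show "\<forall>c\<in>F - {?c}. g (fst c) (snd c) x = 0"
        proof (rule ballI, rule ccontr)
          fix c assume c: "c \<in> F - {?c}" "g (fst c) (snd c) x \<noteq> 0"
          obtain m k where mk: "c = (m, k)" by (cases c)
          have "x \<in> {lo m k<..<hi m k}" using c(2) g(2) mk by force
          then have k: "k = \<lfloor>x * 2 ^ m\<rfloor>" using cell[of x m k] by simp
          then have "chosen m \<lfloor>x * 2 ^ m\<rfloor>" using c(1) mk by (auto simp: F_def)
          then have "c = ?c" using chosen_unique mk k by auto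
          then show False using c(1) by blast
        qed
      qed (use cF in auto)
      then show ?thesis using xU by (simp add: f_def case_prod_beta)
    qed
    then have "\<forall>\<^sub>F x in nhds x0. f x = (\<Sum>(m, k)\<in>F. g m k x)"
      unfolding eventually_nhds_metric using \<rho>(1) by (intro exI[of _ \<rho>]) (auto simp: dist_real_def)
    then show ?thesis using fin by blast
  qed
  have f_bounds: "\<bar>f x\<bar> \<le> e \<and> (\<forall>y. y \<notin> U \<longrightarrow> \<bar>f x\<bar> \<le> e * (x - y)\<^sup>2)" for x
  proof (cases "x \<in> U")
    case True
    let ?k = "\<lfloor>x * 2 ^ lev x\<rfloor>"
    have "good (lev x) ?k" using chosen_lev[OF True] by (simp add: chosen_def)
    moreover have "x \<in> {lo (lev x) ?k..hi (lev x) ?k}" using own[where x = x and m = "lev x"] by simp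
    ultimately have "H (lev x) \<le> e" "\<forall>y. y \<notin> U \<longrightarrow> H (lev x) \<le> e * (x - y)\<^sup>2" unfolding good_def by blast+
    moreover have "\<bar>f x\<bar> \<le> H (lev x)" using g(3)[of "lev x" ?k x] True by (simp add: f_def)
    ultimately show ?thesis by (meson order_trans)
  qed (use \<open>e > 0\<close> in \<open>auto simp: f_def\<close>)
  show ?thesis
  proof (intro exI[of _ f] conjI allI ballI impI)
    show "x \<notin> L_inf f" for x
    proof (cases "x \<in> U")
      case True
      then obtain F where F: "finite F" "\<forall>\<^sub>F t in nhds x. f t = (\<Sum>(m, k)\<in>F. g m k t)"
        using f_sum by blast
      show ?thesis
      proof (rule not_in_L_inf_cong[OF _ F(2)])
        show "x \<notin> L_inf (\<lambda>t. \<Sum>(m, k)\<in>F. g m k t)"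
          unfolding case_prod_beta by (rule not_in_L_inf_sum) (use g(1) lipschitz_not_in_L_inf in blast)
      qed
    next
      case False
      then show ?thesis using f_bounds \<open>e > 0\<close> by (intro quadratic_bound_not_in_L_inf[of f e]) auto
    qed
    show "\<bar>f x\<bar> \<le> e" for x using f_bounds by blast
    show "\<bar>f x\<bar> \<le> e * (x - y)\<^sup>2" if "y \<notin> U" for x y using f_bounds that by blast
    show "\<forall>\<^sub>F y in nhds x. f y = f x" if x: "x \<in> E \<inter> U" for x
    proof -
      obtain F where F: "finite F" "\<forall>\<^sub>F t in nhds x. f t = (\<Sum>(m, k)\<in>F. g m k t)"
        using f_sum x by blast
      have ev: "\<forall>\<^sub>F t in nhds x. \<forall>c\<in>F. g (fst c) (snd c) t = g (fst c) (snd c) x"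
        using F(1) g(5) x by (intro eventually_ball_finite) auto
      have fx: "f x = (\<Sum>(m, k)\<in>F. g m k x)" using eventually_nhds_x_imp_x[OF F(2)] .
      from F(2) ev show ?thesis
      proof eventually_elim
        case (elim t)
        then show ?case using fx by (simp add: case_prod_beta)
      qed
    qed
    show "\<exists>z. \<bar>x - z\<bar> \<le> 1 / N \<and> {min x z..max x z} \<subseteq> U \<and> f x \<noteq> f z \<and> N * \<bar>x - z\<bar> \<le> \<bar>f x - f z\<bar>" if x: "x \<in> U" for x
    proof -
      define m where "m = lev x"
      define k where "k = \<lfloor>x * 2 ^ m\<rfloor>"
      have ch: "chosen m k" using chosen_lev[OF x] by (simp add: m_def k_def)
      have xc: "lo m k \<le> x" "x < hi m k" using cell[of x m k] by (auto simp: k_def)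
      have fx: "f x = g m k x" using f_cell[OF ch] xc by blast
      \<comment> \<open>If the value at \<open>x\<close> is at least half the height, compare with
        the left endpoint, where \<open>f\<close> is \<open>0\<close>; otherwise compare with the
        peak.\<close>
      obtain z where z: "lo m k \<le> z" "z < hi m k" "H m / 2 \<le> \<bar>f x - f z\<bar>"
      proof (cases "H m / 2 \<le> g m k x")
        case True
        have "f (lo m k) = 0" using f_cell[OF ch, of "lo m k"] lohi(1)[of m k] g(2)[of "lo m k" m k] by auto
        then show ?thesis using that[of "lo m k"] True fx lohi(1)[of m k] by auto
      next
        case False
        obtain z where z: "g m k z = H m" using g(4) by blast
        then have zc: "z \<in> {lo m k<..<hi m k}" using g(2)[of z m k] H[of m] by force
        then have "f z = H m" using f_cell[OF ch, of z] z by auto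
        then have "H m / 2 \<le> \<bar>f x - f z\<bar>" using False fx by linarith
        then show ?thesis using that[of z] zc by auto
      qed
      have seg: "{min x z..max x z} \<subseteq> U" using f_cell[OF ch] xc z by (auto simp: min_def max_def split: if_splits)
      have d: "\<bar>x - z\<bar> \<le> 1 / 2 ^ m" using xc z lohi(2)[of m k] by linarith
      moreover have "1 / 2 ^ m \<le> 1 / N" using ch by (simp add: chosen_def good_def)
      ultimately have "\<bar>x - z\<bar> \<le> 1 / N" by (rule order_trans)
      moreover have "N * \<bar>x - z\<bar> \<le> \<bar>f x - f z\<bar>"
      proof -
        have "N * \<bar>x - z\<bar> \<le> N * (1 / 2 ^ m)" using d \<open>N > 0\<close> by (intro mult_left_mono) auto
        also have "\<dots> = H m / 2" by (simp add: H_def)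
        finally show ?thesis using z(3) by linarith
      qed
      moreover have "f x \<noteq> f z" using z(3) H[of m] by auto
      ultimately show ?thesis using seg by blast
    qed
  qed
qed

section \<open>The series\<close>

text \<open>Connectedness of the segment; this is how the earlier terms of the series cancel from
  increments.\<close>

lemma eventually_const_imp_eq_on_segment:
  fixes f :: "real \<Rightarrow> real"
  assumes "{min x z..max x z} \<subseteq> V" "\<And>t. t \<in> V \<Longrightarrow> \<forall>\<^sub>F s in nhds t. f s = f t"
  shows "f x = f z"
proof (rule ccontr)
  assume "f x \<noteq> f z"
  have "f constant_on {min x z..max x z}"
  proof (rule locally_constant_imp_constant)
    fix t assume t: "t \<in> {min x z..max x z}"
    then have "\<forall>\<^sub>F s in nhds t. f s = f t" using assms by blast
    then obtain T where T: "open T" "t \<in> T" "\<forall>s\<in>T. f s = f t" unfolding eventually_nhds by blast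
    have "openin (top_of_set {min x z..max x z}) ({min x z..max x z} \<inter> T)"
      using T(1) by (rule openin_open_Int)
    then show "\<exists>T. openin (top_of_set {min x z..max x z}) T \<and> t \<in> T \<and> (\<forall>s\<in>T. f s = f t)"
      using t T(2,3) by blast
  qed simp
  then obtain c where "\<forall>t\<in>{min x z..max x z}. f t = c" unfolding constant_on_def by blast
  then show False using \<open>f x \<noteq> f z\<close> by simp
qed

text \<open>At a point of \<open>E\<close> two scales alternate: a point just outside
  \<open>U (Suc n)\<close> gives a steep increment, while within half the distance to the complement
  of \<open>U (Suc n)\<close> only the small tail varies.\<close>

lemma trim_gdelta_imp_L_inf:
  fixes E :: "real set"
  assumes "trim E" "gdelta_in euclideanreal E"
  shows "\<exists>f. continuous_on UNIV f \<and> L_inf f = E \<and> (\<forall>x\<in>E. lip_lower f x = 0)"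
proof -
  have E: "E \<in> sets borel" using assms(2) by (rule gdelta_imp_borel)
  obtain G :: "nat \<Rightarrow> real set" where G: "\<And>n. open (G n)" "\<Inter> (range G) = E"
    using assms(2) unfolding gdelta_in_descending by auto
  \<comment> \<open>The conclusion of \<open>oscillating_step\<close> for
    \<open>e = (1 / 2) ^ n\<close> and \<open>N = n + 1\<close>: the first makes the series
    converge, the second makes slopes blow up at shrinking scales.\<close>
  define P where "P U n f \<longleftrightarrow> (\<forall>x. x \<notin> L_inf f) \<and> (\<forall>x. \<bar>f x\<bar> \<le> (1 / 2) ^ n)
    \<and> (\<forall>x y. y \<notin> U \<longrightarrow> \<bar>f x\<bar> \<le> (1 / 2) ^ n * (x - y)\<^sup>2)
    \<and> (\<forall>x\<in>E \<inter> U. \<forall>\<^sub>F y in nhds x. f y = f x)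
    \<and> (\<forall>x\<in>U. \<exists>z. \<bar>x - z\<bar> \<le> 1 / (real n + 1) \<and> {min x z..max x z} \<subseteq> U \<and> f x \<noteq> f z
         \<and> (real n + 1) * \<bar>x - z\<bar> \<le> \<bar>f x - f z\<bar>)" for U n f
  have "\<exists>f. P U n f" if "open U" for U n
    unfolding P_def by (rule oscillating_step[OF E assms(1) that]) auto
  then obtain F where F: "\<And>U n. open U \<Longrightarrow> P U n (F U n)" by metis
  \<comment> \<open>The recursion carries only the open set; the choice function \<open>F\<close>
    recovers \<open>\<phi> n\<close> from it.\<close>
  define U where "U = rec_nat (G 0) (\<lambda>n V. G (Suc n) \<inter> {x \<in> V. \<forall>\<^sub>F y in nhds x. F V n y = F V n x})"
  define \<phi> where "\<phi> n = F (U n) n" for n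
  have U_0: "U 0 = G 0"
    and U_Suc: "U (Suc n) = G (Suc n) \<inter> {x \<in> U n. \<forall>\<^sub>F y in nhds x. \<phi> n y = \<phi> n x}" for n
    by (simp_all add: U_def \<phi>_def)
  have openU: "open (U n)" for n
  proof (induction n)
    case 0
    then show ?case by (simp add: U_0 G)
  next
    case (Suc n)
    have "open {x \<in> U n. \<forall>\<^sub>F y in nhds x. \<phi> n y = \<phi> n x}"
      unfolding open_subopen[of "{x \<in> U n. \<forall>\<^sub>F y in nhds x. \<phi> n y = \<phi> n x}"]
    proof
      fix x assume "x \<in> {x \<in> U n. \<forall>\<^sub>F y in nhds x. \<phi> n y = \<phi> n x}"
      then obtain T where T: "x \<in> U n" "open T" "x \<in> T" "\<forall>y\<in>T. \<phi> n y = \<phi> n x"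
        unfolding eventually_nhds by blast
      have "\<forall>\<^sub>F y in nhds t. \<phi> n y = \<phi> n t" if "t \<in> T" for t
        unfolding eventually_nhds using T(2,4) that by metis
      then show "\<exists>T. open T \<and> x \<in> T \<and> T \<subseteq> {x \<in> U n. \<forall>\<^sub>F y in nhds x. \<phi> n y = \<phi> n x}"
        using T(1-3) Suc by (intro exI[of _ "T \<inter> U n"]) (simp add: open_Int subset_iff)
    qed
    then show ?case using G(1) by (simp add: U_Suc open_Int)
  qed
  have P: "P (U n) n (\<phi> n)" for n unfolding \<phi>_def using F openU by blast
  have nL: "x \<notin> L_inf (\<phi> n)" and bd: "\<bar>\<phi> n x\<bar> \<le> (1 / 2) ^ n"
    and sq: "y \<notin> U n \<Longrightarrow> \<bar>\<phi> n x\<bar> \<le> (1 / 2) ^ n * (x - y)\<^sup>2"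
    and lc: "x \<in> E \<inter> U n \<Longrightarrow> \<forall>\<^sub>F y in nhds x. \<phi> n y = \<phi> n x"
    and osc: "x \<in> U n \<Longrightarrow> \<exists>z. \<bar>x - z\<bar> \<le> 1 / (real n + 1) \<and> {min x z..max x z} \<subseteq> U n \<and> \<phi> n x \<noteq> \<phi> n z
         \<and> (real n + 1) * \<bar>x - z\<bar> \<le> \<bar>\<phi> n x - \<phi> n z\<bar>" for n x y
    using P[of n] unfolding P_def by blast+
  have cont\<phi>: "continuous_on UNIV (\<phi> n)" for n
    using nL not_in_L_inf_imp_isCont by (simp add: continuous_at_imp_continuous_on)
  have U_dec: "U n \<subseteq> U m" if "m \<le> n" for m n
    using that by (induction rule: dec_induct) (auto simp: U_Suc)
  \<comment> \<open>\<open>E\<close> survives each stage because \<open>\<phi> n\<close> is locally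
    constant at the points of \<open>E\<close> in \<open>U n\<close>.\<close>
  have EU: "E \<subseteq> U n" for n
  proof (induction n)
    case 0
    then show ?case using G(2) by (auto simp: U_0)
  next
    case (Suc n)
    then show ?case using G(2) lc[of _ n] by (auto simp: U_Suc)
  qed
  have UG: "U n \<subseteq> G n" for n by (cases n) (auto simp: U_0 U_Suc)
  have const: "\<phi> k x = \<phi> k z" if "k < n" "{min x z..max x z} \<subseteq> U n" for k n x z
  proof (rule eventually_const_imp_eq_on_segment[where V = "U (Suc k)" and f = "\<phi> k" and x = x and z = z])
    show "{min x z..max x z} \<subseteq> U (Suc k)" using that U_dec[of "Suc k" n] by auto
  qed (simp add: U_Suc)
  define f where "f x = (\<Sum>n. \<phi> n x)" for x
  define R where "R n x = (\<Sum>k. \<phi> (k + n) x)" for n x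
  have summ: "summable (\<lambda>n. \<phi> n x)" for x
    by (rule summable_comparison_test[of _ "\<lambda>n. (1 / 2) ^ n"]) (auto intro: bd)
  have f_split: "f x = (\<Sum>k<n. \<phi> k x) + R n x" for n x
    unfolding f_def R_def using suminf_split_initial_segment[OF summ[of x], of n] by simp
  \<comment> \<open>\<open>y\<close> lies outside every later \<open>U (k + n)\<close> as well, so
    the bounds \<open>sq\<close> add up to a geometric series.\<close>
  have R_bound: "\<bar>R n x\<bar> \<le> 2 * (1 / 2) ^ n * (x - y)\<^sup>2" if "y \<notin> U n" for n x y
  proof -
    have 1: "\<bar>\<phi> (k + n) x\<bar> \<le> (1 / 2) ^ k * ((1 / 2) ^ n * (x - y)\<^sup>2)" for k
      using sq[of y "k + n" x] U_dec[of n "k + n"] that by (auto simp: power_add mult.assoc)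
    have s: "(\<lambda>k. (1 / 2 :: real) ^ k * ((1 / 2) ^ n * (x - y)\<^sup>2)) sums (2 * ((1 / 2) ^ n * (x - y)\<^sup>2))"
      using sums_mult2[OF geometric_sums[of "1 / 2 :: real"]] by simp
    have "norm (R n x) \<le> (\<Sum>k. (1 / 2) ^ k * ((1 / 2) ^ n * (x - y)\<^sup>2))"
      unfolding R_def using 1 by (intro norm_suminf_le sums_summable[OF s]) auto
    then show ?thesis using sums_unique[OF s] by (simp add: mult.assoc)
  qed
  have R_0: "R n x = 0" if "x \<notin> U n" for n x using R_bound[OF that, of x] by simp
  have contf: "continuous_on UNIV f"
  proof -
    have "uniform_limit UNIV (\<lambda>n x. \<Sum>i<n. \<phi> i x) (\<lambda>x. \<Sum>i. \<phi> i x) sequentially"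
      by (rule Weierstrass_m_test[of _ _ "\<lambda>n. (1 / 2) ^ n"]) (auto intro: bd)
    then show ?thesis
      unfolding f_def[abs_def]
      by (rule uniform_limit_theorem[rotated]) (auto intro!: always_eventually continuous_on_sum cont\<phi>)
  qed
  \<comment> \<open>Once \<open>x\<close> has left \<open>U n\<close>, the tail is quadratically
    small around \<open>x\<close>, and the finitely many earlier terms have finite
    \<open>Lip\<close>.\<close>
  have outside: "x \<notin> L_inf f" if "x \<notin> E" for x
  proof -
    have "\<exists>n. x \<notin> G n" using \<open>x \<notin> E\<close> G(2) by blast
    then obtain n where "x \<notin> U n" using UG by blast
    then have "x \<notin> L_inf (R n)"
      by (intro quadratic_bound_not_in_L_inf[of _ "2 * (1 / 2) ^ n"] R_bound) auto
    moreover have "x \<notin> L_inf (\<lambda>t. \<Sum>k<n. \<phi> k t)" using nL by (intro not_in_L_inf_sum)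
    ultimately have "x \<notin> L_inf (\<lambda>t. (\<Sum>k<n. \<phi> k t) + R n t)" by (intro not_in_L_inf_add)
    then show ?thesis using f_split[of _ n] by presburger
  qed
  text \<open>The witness \<open>y\<close> is chosen where \<open>\<phi> n\<close> is not locally constant, so that it leaves
    \<open>U (Suc n)\<close> and all later terms of the series vanish at \<open>y\<close>.\<close>
  have witness: "\<exists>y. y \<notin> U (Suc n) \<and> \<bar>x - y\<bar> \<le> 1 / (real n + 1) \<and> x \<noteq> y \<and> real n * \<bar>x - y\<bar> \<le> \<bar>f x - f y\<bar>"
    if "x \<in> E" for x n
  proof -
    have "x \<in> U n" using EU that by blast
    then obtain z where z: "\<bar>x - z\<bar> \<le> 1 / (real n + 1)" "{min x z..max x z} \<subseteq> U n" "\<phi> n x \<noteq> \<phi> n z"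
      "(real n + 1) * \<bar>x - z\<bar> \<le> \<bar>\<phi> n x - \<phi> n z\<bar>" using osc by blast
    obtain y where y: "y \<in> {min x z..max x z}" "\<phi> n y = \<phi> n z" "\<not> (\<forall>\<^sub>F t in nhds y. \<phi> n t = \<phi> n y)"
      using exists_not_locally_constant[OF cont\<phi> z(3)] by blast
    have yU: "y \<notin> U (Suc n)" using y(3) by (simp add: U_Suc)
    have xy: "\<bar>x - y\<bar> \<le> \<bar>x - z\<bar>" using y(1) by auto
    have "{min x y..max x y} \<subseteq> {min x z..max x z}" using y(1) by (auto simp: min_def max_def split: if_splits)
    then have "\<phi> k x = \<phi> k y" if "k < n" for k using const[OF that, of x y] z(2) by blast
    then have "(\<Sum>k<n. \<phi> k x) = (\<Sum>k<n. \<phi> k y)" by simp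
    \<comment> \<open>Earlier terms agree at \<open>x\<close> and \<open>y\<close>, the tail
      vanishes at \<open>y\<close>, and \<open>\<phi> n y = \<phi> n z\<close> gives the full
      increment of \<open>\<phi> n\<close>.\<close>
    then have diff: "f x - f y = \<phi> n x - \<phi> n z + R (Suc n) x"
      using f_split[of x "Suc n"] f_split[of y "Suc n"] R_0[OF yU] y(2) by simp
    have "\<bar>x - y\<bar> \<le> 1" using xy z(1) by (smt (verit) divide_le_eq_1 of_nat_0_le_iff)
    \<comment> \<open>The index \<open>Suc n\<close> absorbs the factor \<open>2\<close> of
      \<open>R_bound\<close>. The tail then costs one unit of slope, which lowers
      \<open>n + 1\<close> to \<open>n\<close>.\<close>
    have "\<bar>R (Suc n) x\<bar> \<le> (1 / 2) ^ n * (x - y)\<^sup>2" using R_bound[OF yU, of x] by simp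
    also have "\<dots> \<le> 1 * (\<bar>x - y\<bar> * 1)"
    proof (intro mult_mono)
      have "(x - y)\<^sup>2 = \<bar>x - y\<bar> * \<bar>x - y\<bar>" by (metis power2_abs power2_eq_square)
      also have "\<dots> \<le> \<bar>x - y\<bar> * 1" using \<open>\<bar>x - y\<bar> \<le> 1\<close> by (intro mult_left_mono) auto
      finally show "(x - y)\<^sup>2 \<le> \<bar>x - y\<bar> * 1" .
    qed (auto simp: power_le_one)
    finally have "\<bar>R (Suc n) x\<bar> \<le> \<bar>x - y\<bar>" by simp
    moreover have "(real n + 1) * \<bar>x - y\<bar> \<le> \<bar>\<phi> n x - \<phi> n z\<bar>"
    proof -
      have "(real n + 1) * \<bar>x - y\<bar> \<le> (real n + 1) * \<bar>x - z\<bar>" using xy by (intro mult_left_mono) auto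
      then show ?thesis using z(4) by linarith
    qed
    ultimately have "real n * \<bar>x - y\<bar> \<le> \<bar>f x - f y\<bar>"
      unfolding diff by (simp add: distrib_right)
    moreover have "x \<noteq> y" using y(2) z(3) by auto
    ultimately show ?thesis using yU xy z(1) by (intro exI[of _ y]) auto
  qed
  have "L_inf f = E"
  proof
    show "L_inf f \<subseteq> E" using outside by blast
    show "E \<subseteq> L_inf f"
    proof
      fix x assume x: "x \<in> E"
      show "x \<in> L_inf f"
      proof (rule in_L_infI)
        fix c \<delta> :: real assume "c > 0" "\<delta> > 0"
        obtain n :: nat where n: "real n > max c (1 / \<delta>)" using reals_Archimedean2 by blast
        obtain y where y: "\<bar>x - y\<bar> \<le> 1 / (real n + 1)" "x \<noteq> y" "real n * \<bar>x - y\<bar> \<le> \<bar>f x - f y\<bar>"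
          using witness[OF x] by blast
        have "1 / (real n + 1) < \<delta>" using n \<open>\<delta> > 0\<close> by (simp add: field_simps)
        moreover have "c * \<bar>x - y\<bar> < real n * \<bar>x - y\<bar>" using n y(2) by (intro mult_strict_right_mono) auto
        ultimately show "\<exists>y. \<bar>x - y\<bar> < \<delta> \<and> c * \<bar>x - y\<bar> < \<bar>f x - f y\<bar>"
          using y by (intro exI[of _ y]) linarith
      qed
    qed
  qed
  moreover have "lip_lower f x = 0" if x: "x \<in> E" for x
  proof (rule lip_lower_eq_0I)
    fix e \<delta> :: real assume "e > 0" "\<delta> > 0"
    obtain n1 :: nat where n1: "real n1 > 1 / \<delta>" using reals_Archimedean2 by blast
    \<comment> \<open>\<open>13 = 4 + 9\<close> comes from the squares of \<open>2 * r\<close> and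
      \<open>3 * r\<close>, which bound the distances of \<open>x\<close> and \<open>t\<close> to
      \<open>w\<close> below.\<close>
    obtain n2 :: nat where n2: "(1 / 2) ^ n2 < e / 13" using real_arch_pow_inv[of "e / 13" "1 / 2"] \<open>e > 0\<close> by auto
    define n where "n = max n1 n2"
    have "(1 / 2 :: real) ^ n \<le> (1 / 2) ^ n2" by (rule power_decreasing) (auto simp: n_def)
    then have n: "13 * (1 / 2) ^ n \<le> e" using n2 by linarith
    have "real n > 1 / \<delta>" using n1 by (simp add: n_def)
    then have n\<delta>: "1 / (real n + 1) < \<delta>" using \<open>\<delta> > 0\<close> by (simp add: field_simps)
    \<comment> \<open>The witness shows that the complement of \<open>U (Suc n)\<close> is nonempty
      and comes within \<open>1 / (n + 1)\<close> of \<open>x\<close>.\<close>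
    obtain y where y: "y \<notin> U (Suc n)" "\<bar>x - y\<bar> \<le> 1 / (real n + 1)" using witness[OF x] by blast
    obtain w where w: "w \<in> - U (Suc n)" "infdist x (- U (Suc n)) = dist x w"
      using infdist_attains_inf[of "- U (Suc n)" x] openU y(1) by auto
    \<comment> \<open>With half the distance to the complement, a segment from \<open>x\<close> of
      length at most \<open>r\<close> stays in \<open>U (Suc n)\<close>, so the terms up to
      \<open>\<phi> n\<close> do not change along it.\<close>
    define r where "r = dist x w / 2"
    have "x \<noteq> w" using EU x w(1) by blast
    then have "r > 0" by (simp add: r_def)
    have wmin: "dist x w \<le> \<bar>x - t\<bar>" if "t \<notin> U (Suc n)" for t
      using infdist_le[of t "- U (Suc n)" x] that w(2) by (simp add: dist_real_def)
    have r\<delta>: "r < \<delta>" "r \<le> 1"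
    proof -
      have "dist x w \<le> 1 / (real n + 1)" using wmin[OF y(1)] y(2) by linarith
      moreover have "1 / (real n + 1) \<le> 1" by simp
      ultimately show "r < \<delta>" "r \<le> 1" using \<open>r > 0\<close> n\<delta> unfolding r_def by linarith+
    qed
    have "\<bar>f x - f t\<bar> \<le> e * r" if t: "\<bar>x - t\<bar> \<le> r" for t
    proof -
      have "s \<in> U (Suc n)" if "s \<in> {min x t..max x t}" for s
      proof (rule ccontr)
        assume "s \<notin> U (Suc n)"
        then have "2 * r \<le> \<bar>x - s\<bar>" using wmin by (simp add: r_def)
        moreover have "\<bar>x - s\<bar> \<le> \<bar>x - t\<bar>" using that by auto
        ultimately show False using t \<open>r > 0\<close> by linarith
      qed
      then have "\<phi> k x = \<phi> k t" if "k < Suc n" for k using const[OF that, of x t] by blast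
      then have "(\<Sum>k<Suc n. \<phi> k x) = (\<Sum>k<Suc n. \<phi> k t)" by (intro sum.cong) auto
      then have "f x - f t = R (Suc n) x - R (Suc n) t"
        using f_split[of x "Suc n"] f_split[of t "Suc n"] by linarith
      moreover have "\<bar>R (Suc n) x\<bar> \<le> (1 / 2) ^ n * (x - w)\<^sup>2" "\<bar>R (Suc n) t\<bar> \<le> (1 / 2) ^ n * (t - w)\<^sup>2"
        using R_bound[of w "Suc n"] w(1) by auto
      ultimately have "\<bar>f x - f t\<bar> \<le> (1 / 2) ^ n * ((x - w)\<^sup>2 + (t - w)\<^sup>2)"
        by (simp add: distrib_left)
      also have "\<dots> \<le> (1 / 2) ^ n * ((2 * r)\<^sup>2 + (3 * r)\<^sup>2)"
      proof (intro mult_left_mono add_mono)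
        have xw: "\<bar>x - w\<bar> = 2 * r" by (simp add: r_def dist_real_def)
        show "(x - w)\<^sup>2 \<le> (2 * r)\<^sup>2" using xw by (metis order_refl power2_abs)
        have "\<bar>t - w\<bar> \<le> 3 * r" using xw t by linarith
        then show "(t - w)\<^sup>2 \<le> (3 * r)\<^sup>2" using power_mono[of "\<bar>t - w\<bar>" "3 * r" 2] by simp
      qed simp
      also have "\<dots> = 13 * (1 / 2) ^ n * (r * r)" by (simp add: power2_eq_square)
      also have "\<dots> \<le> e * (r * 1)" using n \<open>r > 0\<close> \<open>r \<le> 1\<close> \<open>e > 0\<close> by (intro mult_mono) auto
      finally show ?thesis by simp
    qed
    then show "\<exists>r>0. r < \<delta> \<and> (\<forall>y. \<bar>x - y\<bar> \<le> r \<longrightarrow> \<bar>f x - f y\<bar> \<le> e * r)"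
      using \<open>r > 0\<close> r\<delta>(1) by blast
  qed
  ultimately show ?thesis using contf by blast
qed

theorem theorem1:
  shows "(\<forall>f :: real \<Rightarrow> real. continuous_on UNIV f \<and> l_inf f = {} \<longrightarrow>
            trim (L_inf f) \<and> gdelta_in euclideanreal (L_inf f))
       \<and> (\<forall>E :: real set. trim E \<and> gdelta_in euclideanreal E \<longrightarrow>
            (\<exists>f :: real \<Rightarrow> real. continuous_on UNIV f \<and> L_inf f = E \<and> l_inf f = {}
               \<and> (\<forall>x \<in> E. lip_lower f x = 0)))"
proof (intro conjI allI impI)
  fix f :: "real \<Rightarrow> real" assume "continuous_on UNIV f \<and> l_inf f = {}"
  then show "trim (L_inf f)" "gdelta_in euclideanreal (L_inf f)"
    using trim_L_inf gdelta_L_inf by auto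
next
  fix E :: "real set" assume "trim E \<and> gdelta_in euclideanreal E"
  then obtain f where f: "continuous_on UNIV f" "L_inf f = E" "\<forall>x\<in>E. lip_lower f x = 0"
    using trim_gdelta_imp_L_inf by blast
  \<comment> \<open>\<open>l_inf f\<close> is contained in \<open>L_inf f = E\<close>, where
    \<open>lip_lower f\<close> is \<open>0\<close>.\<close>
  have "l_inf f = {}" using f(2,3) l_inf_subset_L_inf[of f] by (fastforce simp: l_inf_def)
  then show "\<exists>f. continuous_on UNIV f \<and> L_inf f = E \<and> l_inf f = {} \<and> (\<forall>x\<in>E. lip_lower f x = 0)"
    using f by blast
qed

end
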